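(* Let $\mathbb{T}$ be the Tribonacci sequence and, for $n\ge1$, let $A(n)$ be the number of distinct nonempty words $\omega$ such that $\omega\omega$ is a factor of $\mathbb{T}[1,n]$. Then $A(n)=0$ for $n\leq7$; $A(n)=1$ for $n=8,9$; $A(n)=2$ for $10\leq n\leq13$. For $n\geq14$, let $m$ be such that $\alpha_m\leq n<\alpha_{m+1}$; then $m\geq4$ and \begin{equation*} A(n)= \begin{cases} n-\frac{1}{2}(t_{m}+t_{m-3}+m+3),&\alpha_m\leq n<\beta_{m};\\ \frac{1}{2}(t_{m-1}+t_{m-2}+4t_{m-3}-m-5),&\beta_{m}\leq n<\gamma_m;\\ n-\frac{1}{2}(t_{m-1}+3t_{m-2}+m+3),&\gamma_m\leq n<\theta_m;\\ \frac{1}{2}(2t_{m-1}+t_{m-2}+3t_{m-3}-m-6),&\theta_m\leq n<\alpha_{m+1}, \end{cases} \end{equation*} where $\alpha_m=2t_{m-1}$, $\beta_m=t_{m}+2t_{m-3}-1$, $\gamma_m=2t_{m}-t_{m-1}$ and $\theta_m=\frac{3t_{m}+t_{m-2}-3}{2}$.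
   Context: The Tribonacci sequence $\mathbb{T}=x_1x_2x_3\cdots$ is the fixed point (infinite word starting with $a$) of the substitution $\sigma(a)=ab$, $\sigma(b)=ac$, $\sigma(c)=a$ over $\{a,b,c\}$. For $n\ge1$, $\mathbb{T}[1,n]=x_1\cdots x_n$ is its prefix of length $n$. The Tribonacci numbers are $t_m=|\sigma^m(a)|$ for $m\ge0$, with $t_{-2}=0$, $t_{-1}=1$; thus $t_0=1,t_1=2,t_2=4$ and $t_m=t_{m-1}+t_{m-2}+t_{m-3}$. *)

theory Defs
  imports Complex_Main "HOL-Library.Sublist"
begin

datatype letter = La | Lb | Lc

fun sigma_letter :: "letter \<Rightarrow> letter list" where
  "sigma_letter La = [La, Lb]"
| "sigma_letter Lb = [La, Lc]"
| "sigma_letter Lc = [La]"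

definition sigma :: "letter list \<Rightarrow> letter list" where
  "sigma w = concat (map sigma_letter w)"

text \<open>The Tribonacci word as an infinite word (function on positions, 0-based):
  x_{i+1} is the i-th letter of sigma^(i+1)(a), which is a prefix of the fixed point
  and has length > i.\<close>
definition trib_word :: "nat \<Rightarrow> letter" where
  "trib_word i = ((sigma ^^ Suc i) [La]) ! i"

definition trib_prefix :: "nat \<Rightarrow> letter list" where
  "trib_prefix n = map trib_word [0..<n]"

definition A_count :: "nat \<Rightarrow> nat" where
  "A_count n = card {w :: letter list. w \<noteq> [] \<and> sublist (w @ w) (trib_prefix n)}"

text \<open>Shifted Tribonacci numbers: trib_shift k = t_{k-2}.\<close>
fun trib_shift :: "nat \<Rightarrow> nat" where
  "trib_shift 0 = 0"
| "trib_shift (Suc 0) = 1"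
| "trib_shift (Suc (Suc 0)) = 1"
| "trib_shift (Suc (Suc (Suc k))) = trib_shift (Suc (Suc k)) + trib_shift (Suc k) + trib_shift k"

text \<open>Tribonacci numbers t_m for integer m \<ge> -2 (t_{-2}=0, t_{-1}=1, t_0=1, t_1=2, ...).\<close>
definition t :: "int \<Rightarrow> int" where
  "t m = int (trib_shift (nat (m + 2)))"

definition alpha :: "nat \<Rightarrow> int" where "alpha m = 2 * t (int m - 1)"
definition beta :: "nat \<Rightarrow> int" where "beta m = t (int m) + 2 * t (int m - 3) - 1"
definition gamma :: "nat \<Rightarrow> int" where "gamma m = 2 * t (int m) - t (int m - 1)"
definition theta :: "nat \<Rightarrow> real" where
  "theta m = (3 * t (int m) + t (int m - 2) - 3) / 2"

end

theory Submission
  imports Defs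
begin

text \<open>
  Write \<open>P j\<close> for the length of the image under \<open>\<sigma>\<close> of the prefix of length \<open>j\<close> of the Tribonacci
  word \<open>T\<close>, so that the image of the letter at \<open>j\<close> starts at \<open>P j\<close>. Since all
  images of letters start with \<open>a\<close>, the suffixes of \<open>T\<close> at the positions \<open>P\<^sup>s j\<close> all share their first
  \<open>H\<^sub>s = t\<^sub>0 + \<dots> + t\<^bsub>s-1\<^esub>\<close> letters. If \<open>x\<close> is the letter at \<open>j\<close> and \<open>p = |\<sigma>\<^sup>s(x)|\<close>, comparing the suffixes at
  \<open>P\<^sup>s j\<close> and \<open>P\<^sup>s (j + 1)\<close> gives a square of period \<open>p\<close> at \<open>P\<^sup>s j + e\<close> whenever \<open>e + p \<le> H\<^sub>s\<close>.
  Conversely, every square arises in this way: the letters \<open>a\<close> mark the block boundaries, so a square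
  desubstitutes to a square of smaller period, except for the images of a few short words.
  The root of such a square is the factor of length \<open>p\<close> at \<open>e\<close>; it is primitive, and its first
  occurrence as a square belongs to the first position \<open>j\<close> carrying \<open>x\<close>. Hence at most one new square
  ends at each position, and it does so exactly in the intervals \<open>[\<alpha>\<^sub>m, \<beta>\<^sub>m]\<close> and \<open>[\<gamma>\<^sub>m, \<theta>\<^sub>m]\<close>.
\<close>

section \<open>The fixed point\<close>

lemma sigma_Nil [simp]: "sigma [] = []"
  and sigma_Cons [simp]: "sigma (x # w) = sigma_letter x @ sigma w"
  and sigma_append [simp]: "sigma (u @ v) = sigma u @ sigma v"
  by (simp_all add: sigma_def)

lemma sigma_funpow_append: "(sigma ^^ n) (u @ v) = (sigma ^^ n) u @ (sigma ^^ n) v"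
  by (induction n) auto

lemma length_sigma_ge: "length w \<le> length (sigma w)"
proof (induction w)
  case (Cons x w)
  then show ?case by (cases x) auto
qed simp

text \<open>Applying \<sigma>(a) = ab first rather than last shows that each iterate is a prefix of
  the next; letters of T may then be read in any long enough iterate.\<close>

lemma sigma_funpow_La_Suc: "(sigma ^^ Suc n) [La] = (sigma ^^ n) [La] @ (sigma ^^ n) [Lb]"
proof -
  have "(sigma ^^ Suc n) [La] = (sigma ^^ n) ([La] @ [Lb])"
    by (simp add: funpow_swap1)
  then show ?thesis by (simp only: sigma_funpow_append)
qed

lemma length_sigma_funpow_ge: "length w \<le> length ((sigma ^^ n) w)"
  by (induction n) (auto intro: order_trans[OF _ length_sigma_ge])

lemma length_sigma_funpow_La: "n < length ((sigma ^^ n) [La])"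
proof (induction n)
  case (Suc n)
  have "1 \<le> length ((sigma ^^ n) [Lb])"
    using length_sigma_funpow_ge[of "[Lb]" n] by simp
  with Suc show ?case unfolding sigma_funpow_La_Suc by simp
qed simp

lemma sigma_funpow_La_nth_add:
  "i < length ((sigma ^^ n) [La]) \<Longrightarrow> (sigma ^^ (n + d)) [La] ! i = (sigma ^^ n) [La] ! i
     \<and> i < length ((sigma ^^ (n + d)) [La])"
proof (induction d)
  case (Suc d)
  then show ?case
    unfolding add_Suc_right sigma_funpow_La_Suc by (simp add: nth_append)
qed simp

lemma trib_word_eq_nth:
  assumes "i < length ((sigma ^^ n) [La])"
  shows "trib_word i = (sigma ^^ n) [La] ! i"
proof (cases "n \<le> Suc i")
  case True
  then show ?thesis
    using sigma_funpow_La_nth_add[OF assms, of "Suc i - n"] by (simp add: trib_word_def del: funpow.simps)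
next
  case False
  have "i < length ((sigma ^^ Suc i) [La])"
    using length_sigma_funpow_La[of "Suc i"] by simp
  from sigma_funpow_La_nth_add[OF this, of "n - Suc i"] False show ?thesis
    by (simp add: trib_word_def del: funpow.simps)
qed

lemma length_trib_prefix [simp]: "length (trib_prefix n) = n"
  by (simp add: trib_prefix_def)

lemma trib_prefix_Suc: "trib_prefix (Suc n) = trib_prefix n @ [trib_word n]"
  by (simp add: trib_prefix_def)

lemma trib_prefix_eq_take:
  "k \<le> length ((sigma ^^ n) [La]) \<Longrightarrow> trib_prefix k = take k ((sigma ^^ n) [La])"
  by (rule nth_equalityI) (auto simp: trib_prefix_def trib_word_eq_nth[of _ n])

text \<open>This is the map \<open>P\<close> of the overview; the iterate
  \<open>block_start ^^ s\<close> gives the starts of the images of letters under the s-th power of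
  \<sigma>.\<close>

definition block_start :: "nat \<Rightarrow> nat" where
  "block_start k = length (sigma (trib_prefix k))"

text \<open>T is fixed by \<sigma>: the prefix of length k lies in \<open>(sigma ^^ k) [La]\<close>,
  so its image is a prefix of the next iterate and hence of T.\<close>

lemma sigma_trib_prefix: "sigma (trib_prefix k) = trib_prefix (block_start k)"
proof -
  define w where "w = (sigma ^^ k) [La]"
  have "k \<le> length w"
    using length_sigma_funpow_La[of k] by (simp add: w_def)
  then have k: "trib_prefix k = take k w"
    unfolding w_def by (rule trib_prefix_eq_take)
  have "(sigma ^^ Suc k) [La] = sigma (take k w) @ sigma (drop k w)"
    by (simp add: w_def flip: sigma_append)
  moreover from this have "block_start k \<le> length ((sigma ^^ Suc k) [La])"
    by (simp add: block_start_def k)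
  ultimately show ?thesis
    by (subst trib_prefix_eq_take[of _ "Suc k"]) (simp_all add: block_start_def k del: funpow.simps)
qed

text \<open>The letter that follows the start of the block of x: the second letter of the blocks ab
  and ac, and, for the one-letter block of c, the a that opens the next block. Being injective, it
  lets x be recovered from this one letter.\<close>

fun next_letter :: "letter \<Rightarrow> letter" where
  "next_letter La = Lb"
| "next_letter Lb = Lc"
| "next_letter Lc = La"

lemma next_letter_eq_iff [simp]: "next_letter x = next_letter y \<longleftrightarrow> x = y"
  by (cases x; cases y) auto

lemma block_start_0 [simp]: "block_start 0 = 0"
  by (simp add: block_start_def trib_prefix_def)

lemma block_start_Suc:
  "block_start (Suc k) = block_start k + (if trib_word k = Lc then 1 else 2)"
  by (cases "trib_word k") (auto simp: block_start_def trib_prefix_Suc)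

lemma trib_prefix_block_start_Suc:
  "trib_prefix (block_start (Suc k)) = trib_prefix (block_start k) @ sigma_letter (trib_word k)"
  by (simp add: trib_prefix_Suc flip: sigma_trib_prefix)

lemma trib_word_block_start [simp]: "trib_word (block_start k) = La"
proof -
  have "trib_word (block_start k) = trib_prefix (block_start (Suc k)) ! block_start k"
    by (auto simp: trib_prefix_def block_start_Suc simp del: upt_Suc)
  also have "\<dots> = La"
    unfolding trib_prefix_block_start_Suc by (cases "trib_word k") (auto simp: nth_append)
  finally show ?thesis .
qed

lemma trib_word_Suc_block_start [simp]:
  "trib_word (Suc (block_start k)) = next_letter (trib_word k)"
proof (cases "trib_word k = Lc")
  case True
  then have "Suc (block_start k) = block_start (Suc k)"
    by (simp add: block_start_Suc)
  with True show ?thesis by (simp only: trib_word_block_start next_letter.simps)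
next
  case False
  then have "trib_word (Suc (block_start k)) = trib_prefix (block_start (Suc k)) ! Suc (block_start k)"
    by (auto simp: trib_prefix_def block_start_Suc simp del: upt_Suc)
  also have "\<dots> = next_letter (trib_word k)"
    unfolding trib_prefix_block_start_Suc using False
    by (cases "trib_word k") (auto simp: nth_append)
  finally show ?thesis .
qed

lemma strict_mono_block_start: "strict_mono block_start"
  by (simp add: strict_mono_Suc_iff block_start_Suc)

lemmas block_start_less_iff [simp] = strict_mono_less[OF strict_mono_block_start]
  and block_start_le_iff [simp] = strict_mono_less_eq[OF strict_mono_block_start]

lemma block_cases:
  obtains j where "i = block_start j"
  | j where "i = Suc (block_start j)" "trib_word j \<noteq> Lc" "block_start (Suc j) = Suc i"
proof -
  have "\<exists>j. i = block_start j \<or> i = Suc (block_start j) \<and> trib_word j \<noteq> Lc"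
  proof (induction i)
    case 0
    show ?case by (rule exI[of _ 0]) simp
  next
    case (Suc i)
    then obtain j where "i = block_start j \<or> i = Suc (block_start j) \<and> trib_word j \<noteq> Lc" by blast
    then have "Suc i = block_start (Suc j) \<or> Suc i = Suc (block_start j) \<and> trib_word j \<noteq> Lc"
      by (auto simp: block_start_Suc)
    then show ?case by blast
  qed
  then show ?thesis
    using that by (auto simp: block_start_Suc)
qed

lemma next_letter_eq_La [simp]: "next_letter x = La \<longleftrightarrow> x = Lc"
  by (cases x) auto

lemma trib_word_eq_La: "trib_word i = La \<Longrightarrow> \<exists>j. i = block_start j"
  by (rule block_cases[of i]) auto

lemma trib_word_Suc_eq_La: "trib_word i \<noteq> La \<Longrightarrow> trib_word (Suc i) = La"
  using trib_word_block_start by (cases i rule: block_cases) metis+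

lemma trib_word_0 [simp]: "trib_word 0 = La"
  using trib_word_block_start[of 0] by simp

section \<open>Agreeing factors\<close>

definition agree :: "nat \<Rightarrow> nat \<Rightarrow> nat \<Rightarrow> bool" where
  "agree i j n \<longleftrightarrow> (\<forall>k<n. trib_word (i + k) = trib_word (j + k))"

lemma agree_mono: "agree i j n \<Longrightarrow> m \<le> n \<Longrightarrow> agree i j m"
  by (auto simp: agree_def)

lemma agree_sym: "agree i j n \<Longrightarrow> agree j i n"
  by (auto simp: agree_def)

lemma agree_trans: "agree i j n \<Longrightarrow> agree j k n \<Longrightarrow> agree i k n"
  by (auto simp: agree_def)

lemma agree_shift: "agree i j (e + n) \<Longrightarrow> agree (i + e) (j + e) n"
  by (auto simp: agree_def add.assoc)

lemma agree_Suc: "agree i j (Suc n) \<longleftrightarrow> agree i j n \<and> trib_word (i + n) = trib_word (j + n)"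
  by (auto simp: agree_def less_Suc_eq)

text \<open>Equal letters have images of equal length, so \<open>P\<close> grows by the same amount
  over both factors; the additive form avoids subtraction of naturals.\<close>

lemma agree_block_start:
  "agree i j n \<Longrightarrow> block_start (i + n) + block_start j = block_start (j + n) + block_start i"
  by (induction n) (auto simp: agree_Suc block_start_Suc)

text \<open>The image gains one letter, as blocks always start with \<open>a\<close>, whatever comes next.\<close>

lemma agree_image:
  assumes "agree i j n"
  shows "agree (block_start i) (block_start j) (Suc (block_start (i + n) - block_start i))"
  using assms
proof (induction n)
  case 0
  then show ?case by (simp add: agree_def)
next
  case (Suc n)
  define d where "d = block_start (i + n) - block_start i"
  have di: "block_start (i + n) = block_start i + d" by (simp add: d_def)
  have a: "agree i j n" and l: "trib_word (i + n) = trib_word (j + n)"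
    using Suc.prems by (auto simp: agree_Suc)
  have dj: "block_start (j + n) = block_start j + d"
    using agree_block_start[OF a] di by simp
  have IH: "agree (block_start i) (block_start j) (Suc d)"
    using Suc.IH[OF a] by (simp add: d_def)
  have nl: "trib_word (block_start i + Suc d) = trib_word (block_start j + Suc d)"
    using trib_word_Suc_block_start[of "i + n"] trib_word_Suc_block_start[of "j + n"] l di dj by simp
  have nn: "trib_word (block_start (i + Suc n)) = trib_word (block_start (j + Suc n))" by simp
  show ?case
  proof (cases "trib_word (i + n) = Lc")
    case True
    then have "block_start (i + Suc n) - block_start i = Suc d"
      using di by (simp add: block_start_Suc)
    then show ?thesis using IH nl by (simp add: agree_Suc)
  next
    case False
    then have "block_start (i + Suc n) = block_start i + Suc (Suc d)"
      "block_start (j + Suc n) = block_start j + Suc (Suc d)"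
      using di dj l by (simp_all add: block_start_Suc)
    then show ?thesis using IH nl nn by (simp add: agree_Suc)
  qed
qed

text \<open>The letter at \<open>i + k\<close> is determined by the one following its block start,
  since \<open>next_letter\<close> is injective. That position must lie inside the known agreement;
  for the block of c it already belongs to the next block, which is where exceptional squares come
  from.\<close>

lemma agree_preimage:
  assumes "agree (block_start i) (block_start j) m"
    and "\<And>k. k < n \<Longrightarrow> Suc (block_start (i + k)) < block_start i + m"
  shows "agree i j n"
  using assms(2)
proof (induction n)
  case 0
  then show ?case by (simp add: agree_def)
next
  case (Suc n)
  then have a: "agree i j n" by simp
  define d where "d = block_start (i + n) - block_start i"
  have di: "block_start (i + n) = block_start i + d" by (simp add: d_def)
  have dj: "block_start (j + n) = block_start j + d"
    using agree_block_start[OF a] di by simp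
  have "Suc d < m" using Suc.prems[of n] di by simp
  then have "trib_word (block_start i + Suc d) = trib_word (block_start j + Suc d)"
    using assms(1) by (auto simp: agree_def)
  then have "next_letter (trib_word (i + n)) = next_letter (trib_word (j + n))"
    using trib_word_Suc_block_start[of "i + n"] trib_word_Suc_block_start[of "j + n"] di dj by simp
  with a show ?case by (simp add: agree_Suc)
qed

section \<open>Lengths of the iterated images\<close>

text \<open>The lengths of the s-th images: t_s for a, t_(s-1) + t_(s-2) for b and t_(s-1) for c.
  The values t_(-1) = 1 and t_(-2) = 0 make s = 0 fit.\<close>

fun image_length :: "nat \<Rightarrow> letter \<Rightarrow> nat" where
  "image_length s La = trib_shift (s + 2)"
| "image_length s Lb = trib_shift (s + 1) + trib_shift s"
| "image_length s Lc = trib_shift (s + 1)"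

lemma block_start_funpow_Suc:
  "(block_start ^^ s) (Suc j) = (block_start ^^ s) j + image_length s (trib_word j)"
proof (induction s arbitrary: j)
  case 0
  then show ?case by (cases "trib_word j") auto
next
  case (Suc s)
  have "(block_start ^^ Suc s) (Suc j) = (block_start ^^ s) (block_start (Suc j))"
    by (simp add: funpow_swap1)
  also have "\<dots> = (block_start ^^ s) (block_start j) + image_length (Suc s) (trib_word j)"
    using Suc[of "Suc (block_start j)"] Suc[of "block_start j"]
    by (cases "trib_word j") (auto simp: block_start_Suc numeral_2_eq_2)
  finally show ?case by (simp add: funpow_swap1)
qed

text \<open>This is \<open>H\<close> of the overview, as \<open>trib_shift (s + 2)\<close> is
  t_s.\<close>

fun overlap :: "nat \<Rightarrow> nat" where
  "overlap 0 = 0"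
| "overlap (Suc s) = overlap s + trib_shift (s + 2)"

lemma block_start_funpow_0 [simp]: "(block_start ^^ s) 0 = 0"
  by (induction s) auto

lemma block_start_funpow_1: "(block_start ^^ s) (Suc 0) = trib_shift (s + 2)"
  using block_start_funpow_Suc[of s 0] by simp

text \<open>Taking images turns an agreement of length H_s into one of length P(H_s) + 1. To
  identify this with H_(s+1), the agreement between positions t_s and 0 is used: it gives P(t_s +
  H_s) = t_(s+1) + P(H_s), which is the recursion of \<open>overlap\<close>.\<close>

lemma overlap_agree_aux:
  "(\<forall>j. agree ((block_start ^^ s) j) 0 (overlap s)) \<and> Suc (block_start (overlap s)) = overlap (Suc s)"
proof (induction s)
  case 0
  then show ?case by (simp add: agree_def numeral_2_eq_2)
next
  case (Suc s)
  have a: "agree ((block_start ^^ s) j) 0 (overlap s)" for j using Suc by blast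
  have b: "Suc (block_start (overlap s)) = overlap (Suc s)" using Suc by blast
  have ag: "agree ((block_start ^^ Suc s) j) 0 (overlap (Suc s))" for j
    using agree_sym[OF agree_image[OF agree_sym[OF a[of j]]]] b by simp
  have "block_start (trib_shift (s + 2) + overlap s) = block_start (trib_shift (s + 2)) + block_start (overlap s)"
    using agree_block_start[OF a[of "Suc 0"]] by (simp add: block_start_funpow_1)
  moreover have "block_start (trib_shift (s + 2)) = trib_shift (Suc s + 2)"
    using block_start_funpow_1[of "Suc s"] by (simp add: block_start_funpow_1 del: trib_shift.simps)
  ultimately have "Suc (block_start (overlap (Suc s))) = overlap (Suc (Suc s))"
    using b by (simp add: add.commute del: trib_shift.simps)
  with ag show ?case by blast
qed

lemma agree_block_start_funpow: "agree ((block_start ^^ s) j) 0 (overlap s)"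
  using overlap_agree_aux by blast

lemma Suc_block_start_overlap: "Suc (block_start (overlap s)) = overlap (Suc s)"
  using overlap_agree_aux by blast

lemma trib_shift_pos: "0 < trib_shift (Suc n)"
  by (induction n rule: trib_shift.induct) auto

lemma image_length_pos: "0 < image_length s x"
  using trib_shift_pos by (cases x) (auto simp: numeral_2_eq_2)

section \<open>Occurrences of squares\<close>

definition square_at :: "nat \<Rightarrow> nat \<Rightarrow> bool" where
  "square_at i p \<longleftrightarrow> 0 < p \<and> agree i (i + p) p"

text \<open>A factor of period \<open>r + 1\<close> and length \<open>2 r + 1\<close> that is not extendable to a square on
  either side because of the letter \<open>x\<close>. For \<open>x = c\<close> its image followed by \<open>a\<close> is a square,
  since \<open>\<sigma>(c) = a\<close> is a prefix of every block.\<close>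

definition near_square :: "letter \<Rightarrow> nat \<Rightarrow> nat \<Rightarrow> bool" where
  "near_square x j r \<longleftrightarrow> agree j (j + Suc r) r \<and> trib_word (j + r) = x
     \<and> trib_word (j + Suc r + r) \<noteq> x \<and> (\<forall>i. j = Suc i \<longrightarrow> trib_word i \<noteq> x)"

text \<open>For r > 0 the letter before the mismatch is a, so the first copy ends in aa. The factor
  aa occurs only where the block of c is followed by the block ab, so the second copy, and hence the
  first, starts with b; but b is preceded by a, against the condition on the left.\<close>

lemma near_square_La: "near_square La j r \<Longrightarrow> r = 0"
proof (rule ccontr)
  assume n: "near_square La j r" and "r \<noteq> 0"
  then obtain q where r: "r = Suc q" by (cases r) auto
  have ag: "\<And>k. k < r \<Longrightarrow> trib_word (j + k) = trib_word (j + Suc r + k)"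
    using n by (auto simp: near_square_def agree_def)
  have "trib_word (j + Suc r + q) = La"
    using trib_word_Suc_eq_La[of "j + Suc r + q"] n r by (auto simp: near_square_def)
  then have "trib_word (j + q) = La" using ag[of q] r by simp
  then obtain m where m: "j + q = block_start m" using trib_word_eq_La by blast
  have "trib_word (Suc (j + q)) = La" using n r by (simp add: near_square_def)
  then have "trib_word m = Lc" using m by simp
  then have m1: "block_start (Suc m) = j + r" and "trib_word (Suc m) = La"
    using m r by (auto simp: block_start_Suc trib_word_Suc_eq_La)
  then have "trib_word (j + Suc r) = Lb"
    using trib_word_Suc_block_start[of "Suc m"] by simp
  then have jb: "trib_word j = Lb" using ag[of 0] r by simp
  then obtain i where i: "j = Suc i" by (cases j) auto
  then have "trib_word i \<noteq> La" using n by (auto simp: near_square_def)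
  then show False using trib_word_Suc_eq_La[of i] i jb by simp
qed

text \<open>The letter at \<open>j + r\<close> closes a two-letter block, so an a follows it; as r >
  0, the agreement carries this a back to \<open>j\<close>, which is thus a block start. The
  mismatch and the condition on the left pass to the preimage through
  \<open>next_letter\<close>.\<close>

lemma near_square_next_letter:
  assumes n: "near_square (next_letter x) j r" and x: "x \<noteq> Lc" and r: "r \<noteq> 0"
  obtains i q where "j = block_start i" "near_square x i q"
    "block_start (i + Suc q) = j + Suc r"
proof -
  have ag: "agree j (j + Suc r) r" and l: "trib_word (j + r) = next_letter x"
    using n by (auto simp: near_square_def)
  obtain m where m: "j + r = Suc (block_start m)" "block_start (Suc m) = j + Suc r"
    using block_cases[of "j + r"] l x
    by (metis add_Suc_right next_letter_eq_La trib_word_block_start)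
  have mx: "trib_word m = x" using l m(1) by simp
  have "trib_word (j + Suc r) = La" using trib_word_block_start[of "Suc m"] m(2) by simp
  then have "trib_word j = La" using ag r by (auto simp: agree_def)
  then obtain i where i: "j = block_start i" using trib_word_eq_La by blast
  then have "block_start i < block_start (Suc m)" using m(2) by simp
  then have "i \<le> m" by simp
  then obtain q where q: "m = i + q" using le_Suc_ex by blast
  have ag': "agree i (i + Suc q) q"
  proof (rule agree_preimage)
    show "agree (block_start i) (block_start (i + Suc q)) r"
      using ag i m q by simp
    fix k assume "k < q"
    then have "block_start (i + k) < block_start m" using q by simp
    then show "Suc (block_start (i + k)) < block_start i + r" using i m by simp
  qed
  have "block_start (i + Suc q + q) = block_start m + Suc r"
    using agree_block_start[OF ag'] i m q by simp
  then have "trib_word (j + Suc r + r) = next_letter (trib_word (i + Suc q + q))"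
    using trib_word_Suc_block_start[of "i + Suc q + q"] m(1)
    by (metis add.commute add_Suc_right add.left_commute)
  then have "trib_word (i + Suc q + q) \<noteq> x" using n by (auto simp: near_square_def)
  moreover have "trib_word h \<noteq> x" if "i = Suc h" for h
  proof
    assume h: "trib_word h = x"
    then have "j = Suc (Suc (block_start h))" using that i x by (simp add: block_start_Suc)
    moreover have "trib_word (Suc (block_start h)) = next_letter x" using h by simp
    ultimately show False using n by (auto simp: near_square_def)
  qed
  ultimately have "near_square x i q"
    using ag' mx q by (auto simp: near_square_def)
  moreover have "block_start (i + Suc q) = j + Suc r" using m q by simp
  ultimately show thesis using that i by blast
qed

text \<open>Desubstitution replaces c by b and b by a, and ends with r = 0, at the latest at a. What
  remains is a single letter c, b or a, with s = 1, 2, 3 respectively; its s-th image has length 1,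
  3 or 7, exactly \<open>overlap s\<close>.\<close>

lemma near_square_Lc:
  assumes "near_square Lc j r"
  obtains s i where "block_start j = (block_start ^^ s) i"
    "block_start (j + Suc r) = (block_start ^^ s) (Suc i)"
    "image_length s (trib_word i) \<le> overlap s"
proof (cases "r = 0")
  case True
  with assms that[of 1 j] show thesis
    by (simp add: near_square_def numeral_2_eq_2)
next
  case False
  with assms near_square_next_letter[of Lb j r] obtain i q
    where i: "j = block_start i" "near_square Lb i q" "block_start (i + Suc q) = j + Suc r"
    by auto
  show thesis
  proof (cases "q = 0")
    case True
    with i that[of 2 i] show thesis
      by (simp add: near_square_def numeral_2_eq_2)
  next
    case False
    with i near_square_next_letter[of La i q] obtain h p
      where h: "i = block_start h" "near_square La h p" "block_start (h + Suc p) = i + Suc q"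
      by auto
    moreover have "p = 0" using h near_square_La by blast
    ultimately show thesis using i that[of 3 h]
      by (simp add: near_square_def numeral_2_eq_2 numeral_3_eq_3)
  qed
qed

lemma square_at_preimage:
  assumes "square_at i p"
  obtains (square) j q where "square_at j q" "block_start (j + q) = block_start j + p"
      "i = block_start j \<or> i = Suc (block_start j)"
  | (near) j r where "near_square Lc j r" "i = block_start j"
      "block_start (j + Suc r) = block_start j + p"
proof (cases i rule: block_cases)
  case (1 j)
  have p: "0 < p" and ag: "agree i (i + p) p" using assms by (auto simp: square_at_def)
  then have "trib_word (i + p) = La" using 1 by (auto simp: agree_def)
  then obtain j2 where j2: "i + p = block_start j2" using trib_word_eq_La by blast
  then have "block_start j < block_start j2" using 1 p by linarith
  then have "j < j2" by simp
  then obtain r where r: "j2 = j + Suc r" using less_imp_Suc_add by auto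
  have ag': "agree (block_start j) (block_start (j + Suc r)) p" using ag 1 j2 r by simp
  have bp: "block_start (j + Suc r) = block_start j + p" using 1 j2 r by simp
  have agr: "agree j (j + Suc r) r"
  proof (rule agree_preimage[OF ag'])
    fix k assume "k < r"
    then have "block_start (j + k) < block_start (j + r)" "block_start (j + r) < block_start (j + Suc r)"
      by simp_all
    then show "Suc (block_start (j + k)) < block_start j + p" using bp by linarith
  qed
  show thesis
  proof (cases "trib_word (j + r) = trib_word (j + Suc r + r)")
    case True
    with agr have "square_at j (Suc r)" by (simp add: square_at_def agree_Suc)
    with bp 1 square show thesis by blast
  next
    case ne: False
    \<comment> \<open>A two-letter last block would have its second letter inside the agreement,
      which would force the last letters to match.\<close>
    have c: "trib_word (j + r) = Lc"
    proof (rule ccontr)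
      assume "trib_word (j + r) \<noteq> Lc"
      then have "Suc (block_start (j + r)) < block_start j + p"
        using bp by (simp add: block_start_Suc)
      then have "agree j (j + Suc r) (Suc r)"
        by (intro agree_preimage[OF ag']) (auto intro: le_less_trans[rotated] simp: less_Suc_eq_le)
      with ne show False by (simp add: agree_Suc)
    qed
    \<comment> \<open>If a c also precedes \<open>j\<close>, the preimage square starts one letter
      earlier, at \<open>h\<close>, whose one-letter block ends just before
      \<open>i\<close>.\<close>
    show thesis
    proof (cases "\<exists>h. j = Suc h \<and> trib_word h = Lc")
      case True
      then obtain h where h: "j = Suc h" "trib_word h = Lc" by blast
      have "trib_word (h + k) = trib_word (h + Suc r + k)" if "k < Suc r" for k
        using that c agr h by (cases k) (auto simp: agree_def)
      then have "square_at h (Suc r)" by (simp add: square_at_def agree_def)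
      moreover have "block_start (h + Suc r) = block_start h + p"
        using bp c h by (simp add: block_start_Suc)
      moreover have "i = Suc (block_start h)" using h 1 by (simp add: block_start_Suc)
      ultimately show thesis using square by blast
    next
      case False
      then have "near_square Lc j r" using agr c ne by (auto simp: near_square_def)
      then show thesis using near bp 1 by blast
    qed
  qed
next
  case (2 j)
  have p: "0 < p" and ag: "agree i (i + p) p" using assms by (auto simp: square_at_def)
  have Ti: "trib_word i = next_letter (trib_word j)" and Ti': "trib_word i \<noteq> La"
    using 2 by simp_all
  have Tip: "trib_word (i + p) = trib_word i" using ag p by (auto simp: agree_def)
  then obtain m where m: "i + p = Suc (block_start m)" "trib_word m \<noteq> Lc"
      "block_start (Suc m) = Suc (i + p)"
    using block_cases[of "i + p"] Ti' by (metis trib_word_block_start)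
  have bm: "block_start m = block_start j + p" using m 2 by simp
  then have "block_start j < block_start m" using p by simp
  then obtain q where q: "m = j + q" "0 < q"
    using less_imp_add_positive[of j m] by auto
  \<comment> \<open>Both copies start at the second letter of a block, so the a before each extends
    the agreement to the left.\<close>
  have ag': "agree (block_start j) (block_start m) (Suc p)"
    unfolding agree_def
  proof (intro allI impI)
    fix k assume "k < Suc p"
    then show "trib_word (block_start j + k) = trib_word (block_start m + k)"
      using ag bm 2 trib_word_block_start[of m] by (cases k) (auto simp: agree_def)
  qed
  have "agree j (j + q) q"
  proof (rule agree_preimage)
    show "agree (block_start j) (block_start (j + q)) (Suc p)" using ag' q by simp
    fix k assume "k < q"
    then have "block_start (j + k) < block_start m" using q by simp
    then show "Suc (block_start (j + k)) < block_start j + Suc p" using bm by simp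
  qed
  then have "square_at j q" using q by (simp add: square_at_def)
  then show thesis using square bm q 2 by blast
qed

section \<open>Growth of periods under \<sigma> and the classification of all squares\<close>

lemma block_start_add_ge: "block_start j + n \<le> block_start (j + n)"
  by (induction n) (auto simp: block_start_Suc)

text \<open>The root contains a letter other than c, whose image has length 2: its first letter, or,
  if that is c, the a after it. This makes the induction on the period below well founded.\<close>

lemma square_at_period_less:
  assumes "square_at j q" "block_start (j + q) = block_start j + p"
  shows "q < p"
proof (cases "trib_word j = Lc")
  case True
  then have n: "trib_word (Suc j) = La" by (simp add: trib_word_Suc_eq_La)
  have "trib_word (j + q) = Lc" "0 < q" using assms True by (auto simp: square_at_def agree_def)
  then have "q \<noteq> 1" "0 < q" using n by auto
  then obtain k where k: "q = Suc (Suc k)" by (metis One_nat_def gr0_implies_Suc old.nat.exhaust)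
  have "block_start (Suc (Suc j)) + k \<le> block_start (j + q)"
    using block_start_add_ge[of "Suc (Suc j)" k] k by simp
  then show ?thesis using assms True n k by (simp add: block_start_Suc)
next
  case False
  obtain k where k: "q = Suc k" using assms by (cases q) (auto simp: square_at_def)
  have "block_start (Suc j) + k \<le> block_start (j + q)"
    using block_start_add_ge[of "Suc j" k] k by simp
  then show ?thesis using assms False k by (simp add: block_start_Suc)
qed

lemma block_start_funpow_add:
  assumes "e \<le> overlap s"
  shows "block_start ((block_start ^^ s) j + e) = (block_start ^^ Suc s) j + block_start e"
  using agree_block_start[OF agree_mono[OF agree_block_start_funpow assms], of j] by simp

lemma square_at_imp:
  "square_at i p \<Longrightarrow>
    \<exists>s j e. i = (block_start ^^ s) j + e \<and> p = image_length s (trib_word j) \<and> e + p \<le> overlap s"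
proof (induction p arbitrary: i rule: less_induct)
  case (less p)
  from less.prems show ?case
  proof (cases rule: square_at_preimage)
    case (near j r)
    then obtain s h where h: "block_start j = (block_start ^^ s) h"
      "block_start (j + Suc r) = (block_start ^^ s) (Suc h)"
      "image_length s (trib_word h) \<le> overlap s"
      using near_square_Lc by metis
    then have "i = (block_start ^^ s) h + 0 \<and> p = image_length s (trib_word h) \<and> 0 + p \<le> overlap s"
      using near by (simp add: block_start_funpow_Suc)
    then show ?thesis by blast
  next
    case (square j1 q)
    then have "q < p" using square_at_period_less by blast
    with less.IH square obtain s j e where
      j: "j1 = (block_start ^^ s) j + e" "q = image_length s (trib_word j)" "e + q \<le> overlap s"
      by blast
    let ?l = "image_length (Suc s) (trib_word j)"
    have b: "block_start j1 = (block_start ^^ Suc s) j + block_start e"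
      using block_start_funpow_add[of e s j] j by simp
    have e: "e \<le> overlap s" using j by simp
    have "j1 + q = (block_start ^^ s) (Suc j) + e"
      using j by (simp add: block_start_funpow_Suc)
    then have b2: "block_start (j1 + q) = (block_start ^^ Suc s) j + ?l + block_start e"
      using block_start_funpow_Suc[of "Suc s" j] by (simp only: block_start_funpow_add[OF e])
    then have p: "p = ?l" using b square by simp
    have "block_start (j1 + q) = (block_start ^^ Suc s) j + block_start (e + q)"
      using block_start_funpow_add[of "e + q" s j] j by (simp add: add.assoc)
    then have "block_start (e + q) = ?l + block_start e" using b2 by simp
    moreover have "block_start (e + q) \<le> block_start (overlap s)" using j by simp
    ultimately have le: "Suc (block_start e) + p \<le> overlap (Suc s)"
      unfolding p using Suc_block_start_overlap[of s] by simp
    \<comment> \<open>Lifting one level turns the offset e into P(e) or P(e) + 1; the extra letter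
      in H_(s+1) = P(H_s) + 1 leaves room for the second choice.\<close>
    obtain e' where "i = (block_start ^^ Suc s) j + e'" "e' \<le> Suc (block_start e)"
    proof (cases "i = block_start j1")
      case True
      then show thesis using that[of "block_start e"] b by simp
    next
      case False
      then show thesis using that[of "Suc (block_start e)"] b square by simp
    qed
    moreover have "e' + p \<le> overlap (Suc s)" using calculation le by simp
    ultimately show ?thesis using p by blast
  qed
qed

lemma square_at_iff:
  "square_at i p \<longleftrightarrow>
    (\<exists>s j e. i = (block_start ^^ s) j + e \<and> p = image_length s (trib_word j) \<and> e + p \<le> overlap s)"
proof
  assume "\<exists>s j e. i = (block_start ^^ s) j + e \<and> p = image_length s (trib_word j) \<and> e + p \<le> overlap s"
  then obtain s j e where
    h: "i = (block_start ^^ s) j + e" "p = image_length s (trib_word j)" "e + p \<le> overlap s" by blast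
  have "agree ((block_start ^^ s) j) ((block_start ^^ s) (Suc j)) (e + p)"
    using agree_trans agree_sym agree_mono agree_block_start_funpow h(3) by meson
  then have "agree i (i + p) p"
    using agree_shift h by (metis add.commute add.left_commute block_start_funpow_Suc)
  then show "square_at i p" using h image_length_pos by (simp add: square_at_def)
qed (rule square_at_imp)


section \<open>Primitivity of the roots\<close>

definition factor :: "nat \<Rightarrow> nat \<Rightarrow> letter list" where
  "factor i n = map trib_word [i..<i + n]"

lemma length_factor [simp]: "length (factor i n) = n"
  by (simp add: factor_def)

lemma factor_add: "factor i (m + n) = factor i m @ factor (i + m) n"
  using upt_add_eq_append[of i "i + m" n] by (simp add: factor_def add.assoc)

lemma factor_eq_iff: "factor i n = factor j n \<longleftrightarrow> agree i j n"
  by (auto simp: factor_def agree_def list_eq_iff_nth_eq)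

lemma trib_prefix_add: "trib_prefix (i + n) = trib_prefix i @ factor i n"
  using upt_add_eq_append[of 0 i n] by (simp add: trib_prefix_def factor_def)

lemma sigma_factor: "sigma (factor i n) = factor (block_start i) (block_start (i + n) - block_start i)"
proof -
  have "trib_prefix (block_start (i + n)) = trib_prefix (block_start i) @ sigma (factor i n)"
    by (simp add: trib_prefix_add flip: sigma_trib_prefix)
  moreover have "block_start (i + n) = block_start i + (block_start (i + n) - block_start i)"
    by simp
  ultimately show ?thesis by (metis trib_prefix_add same_append_eq)
qed

lemma sigma_funpow_letter:
  "(sigma ^^ s) [trib_word j] = factor ((block_start ^^ s) j) (image_length s (trib_word j))"
proof (induction s)
  case 0
  then show ?case by (cases "trib_word j") (auto simp: factor_def)
next
  case (Suc s)
  have "block_start ((block_start ^^ s) j + image_length s (trib_word j)) = (block_start ^^ Suc s) (Suc j)"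
    by (simp add: block_start_funpow_Suc)
  also have "\<dots> = (block_start ^^ Suc s) j + image_length (Suc s) (trib_word j)"
    by (rule block_start_funpow_Suc)
  finally show ?case
    using Suc by (simp add: sigma_factor del: image_length.simps)
qed

lemma count_list_sigma:
  "count_list (sigma w) La = length w"
  "count_list (sigma w) Lb = count_list w La"
  "count_list (sigma w) Lc = count_list w Lb"
proof (induction w)
  case (Cons x w)
  { case 1 then show ?case using Cons by (cases x) auto }
  { case 2 then show ?case using Cons by (cases x) auto }
  { case 3 then show ?case using Cons by (cases x) auto }
qed simp_all

lemma length_eq_count_letters:
  "length w = count_list w La + count_list w Lb + count_list w Lc"
proof (induction w)
  case (Cons x w)
  then show ?case by (cases x) auto
qed simp

text \<open>The incidence matrix of \<open>\<sigma>\<close> is unimodular, so common divisors of the letter counts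
  are not created by iteration.\<close>

lemma dvd_count_sigma_funpow:
  "(\<And>y. k dvd count_list ((sigma ^^ s) w) y) \<Longrightarrow> k dvd count_list w x"
proof (induction s arbitrary: x)
  case (Suc s)
  let ?v = "(sigma ^^ s) w"
  have d: "k dvd length ?v" "k dvd count_list ?v La" "k dvd count_list ?v Lb"
    using Suc.prems[of La] Suc.prems[of Lb] Suc.prems[of Lc] by (simp_all add: count_list_sigma)
  then have "k dvd count_list ?v Lc"
    using length_eq_count_letters[of ?v] by (metis dvd_add dvd_add_right_iff)
  with d have "k dvd count_list ?v y" for y by (cases y) auto
  then show ?case using Suc.IH by blast
qed simp

lemma count_list_concat_replicate: "count_list (concat (replicate n zs)) y = n * count_list zs y"
  by (induction n) auto

text \<open>Zero-based positions of the first occurrences, as T starts with abac.\<close>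

fun first_index :: "letter \<Rightarrow> nat" where
  "first_index La = 0"
| "first_index Lb = 1"
| "first_index Lc = 3"

lemma block_start_1: "block_start (Suc 0) = 2"
  by (simp add: block_start_Suc)

lemma trib_word_1: "trib_word (Suc 0) = Lb"
  using trib_word_Suc_block_start[of 0] by simp

lemma trib_word_2: "trib_word (Suc (Suc 0)) = La"
  using trib_word_block_start[of 1] by (simp add: block_start_1 numeral_2_eq_2)

lemma trib_word_3: "trib_word (Suc (Suc (Suc 0))) = Lc"
  using trib_word_Suc_block_start[of 1] by (simp add: block_start_1 trib_word_1 numeral_2_eq_2)

lemma trib_word_first_index [simp]: "trib_word (first_index x) = x"
  by (cases x) (simp_all add: trib_word_1 trib_word_3 numeral_3_eq_3)

lemma first_index_le: "first_index (trib_word j) \<le> j"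
proof (cases "j < 3")
  case True
  then have "j = 0 \<or> j = Suc 0 \<or> j = Suc (Suc 0)" by auto
  then show ?thesis by (auto simp: trib_word_1 trib_word_2)
next
  case False
  then show ?thesis by (cases "trib_word j") auto
qed

text \<open>The prefix of T of length H_s has the length of the s-th image of x as a period: it
  occurs at the start of that image and again at its end.\<close>

lemma agree_period:
  assumes "i + image_length s x + n \<le> overlap s"
  shows "agree i (i + image_length s x) n"
proof -
  let ?p = "image_length s x" and ?J = "(block_start ^^ s) (first_index x)"
  have 1: "agree (?J + (i + ?p)) (0 + (i + ?p)) n"
    using assms by (intro agree_shift agree_mono[OF agree_block_start_funpow]) simp
  have "agree ((block_start ^^ s) (Suc (first_index x)) + i) (0 + i) n"
    using assms by (intro agree_shift agree_mono[OF agree_block_start_funpow]) simp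
  moreover have "(block_start ^^ s) (Suc (first_index x)) + i = ?J + (i + ?p)"
    by (simp add: block_start_funpow_Suc)
  ultimately have 2: "agree (?J + (i + ?p)) i n" by simp
  from agree_trans[OF agree_sym[OF 2] 1] show ?thesis by simp
qed

text \<open>Inside the periodic prefix, the factor at \<open>e\<close> is a rotation of the one at
  0, which is the s-th image of x.\<close>

lemma count_list_factor_period:
  assumes "e + image_length s x \<le> overlap s" "e \<le> image_length s x"
  shows "count_list (factor e (image_length s x)) y = count_list ((sigma ^^ s) [x]) y"
proof -
  let ?p = "image_length s x" and ?J = "(block_start ^^ s) (first_index x)"
  have "factor 0 e = factor ?p e"
    using agree_period[of 0 s x e] assms by (simp add: factor_eq_iff add.commute)
  moreover have "factor 0 ?p = factor 0 e @ factor e (?p - e)"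
    using factor_add[of 0 e "?p - e"] assms by simp
  moreover have "factor e ?p = factor e (?p - e) @ factor ?p e"
    using factor_add[of e "?p - e" e] assms by simp
  ultimately have "count_list (factor e ?p) y = count_list (factor 0 ?p) y" by simp
  moreover have "factor ?J ?p = factor 0 ?p"
    using agree_mono[OF agree_block_start_funpow[of s "first_index x"], of ?p] assms
    by (simp add: factor_eq_iff)
  ultimately show ?thesis
    using sigma_funpow_letter[of s "first_index x"] by simp
qed

text \<open>Equality would make the root equal to a proper rotation of itself, AB = BA, so a power
  with exponent m + n at least 2. This exponent would divide all letter counts of the s-th image of
  x, and by unimodularity the count 1 of x in \<open>[x]\<close>.\<close>

lemma factor_period_inj_less:
  assumes "e < e'" "e' < image_length s x" "e' + image_length s x \<le> overlap s"
  shows "factor e (image_length s x) \<noteq> factor e' (image_length s x)"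
proof
  let ?p = "image_length s x"
  assume eq: "factor e ?p = factor e' ?p"
  define d where "d = e' - e"
  have d: "e' = e + d" "0 < d" "d < ?p" using assms by (auto simp: d_def)
  define A where "A = factor e d"
  define B where "B = factor e' (?p - d)"
  have AB: "factor e ?p = A @ B"
    using factor_add[of e d "?p - d"] d by (simp add: A_def B_def)
  have "agree e (e + ?p) d"
    using assms d by (intro agree_period) simp
  then have "factor (e' + (?p - d)) d = A"
    unfolding A_def using d by (auto simp: factor_eq_iff add.assoc dest: agree_sym)
  then have BA: "factor e' ?p = B @ A"
    using factor_add[of e' "?p - d" d] d by (simp add: B_def)
  from eq AB BA have "A @ B = B @ A" by simp
  then obtain m n zs where mn: "concat (replicate m zs) = A" "concat (replicate n zs) = B"
    using comm_append_are_replicate by blast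
  have ne: "length A = d" "length B = ?p - d" by (simp_all add: A_def B_def)
  then have "m \<noteq> 0" "n \<noteq> 0" using mn d by (auto intro: ccontr)
  have "count_list ((sigma ^^ s) [x]) y = (m + n) * count_list zs y" for y
    using count_list_factor_period[of e s x y] assms AB
    by (simp add: count_list_concat_replicate add_mult_distrib flip: mn)
  then have "(m + n) dvd count_list ((sigma ^^ s) [x]) y" for y by simp
  then have "(m + n) dvd count_list [x] x" by (rule dvd_count_sigma_funpow)
  then show False using \<open>m \<noteq> 0\<close> \<open>n \<noteq> 0\<close> by simp
qed

lemma factor_period_inj:
  assumes "factor e (image_length s x) = factor e' (image_length s x)"
    and "e < image_length s x" "e + image_length s x \<le> overlap s"
    and "e' < image_length s x" "e' + image_length s x \<le> overlap s"
  shows "e = e'"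
  using factor_period_inj_less[of e e' s x] factor_period_inj_less[of e' e s x] assms
  by (cases e e' rule: linorder_cases) auto

section \<open>First occurrences\<close>

lemma trib_square_iff:
  "w \<noteq> [] \<and> sublist (w @ w) (trib_prefix n) \<longleftrightarrow>
    (\<exists>i p. square_at i p \<and> i + 2 * p \<le> n \<and> w = factor i p)"
proof
  assume h: "w \<noteq> [] \<and> sublist (w @ w) (trib_prefix n)"
  then obtain u v where uv: "trib_prefix n = u @ (w @ w) @ v"
    by (auto simp: sublist_def)
  let ?i = "length u" and ?p = "length w"
  have "length (trib_prefix n) = length (u @ (w @ w) @ v)" using uv by simp
  then have n: "n = ?i + (?p + (?p + length v))" by simp
  have "u @ (w @ w) @ v = trib_prefix ?i @ (factor ?i ?p @ factor (?i + ?p) ?p) @ factor (?i + ?p + ?p) (length v)"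
    using uv by (subst (asm) n) (simp add: trib_prefix_add factor_add)
  then have "w = factor ?i ?p" "w = factor (?i + ?p) ?p" by auto
  then have "square_at ?i ?p" using h by (metis factor_eq_iff length_greater_0_conv square_at_def)
  with \<open>w = factor ?i ?p\<close> n show "\<exists>i p. square_at i p \<and> i + 2 * p \<le> n \<and> w = factor i p"
    by (intro exI[of _ ?i] exI[of _ ?p]) auto
next
  assume "\<exists>i p. square_at i p \<and> i + 2 * p \<le> n \<and> w = factor i p"
  then obtain i p where h: "square_at i p" "i + 2 * p \<le> n" "w = factor i p" by blast
  then have n: "n = i + (p + (p + (n - i - 2 * p)))" by simp
  have "factor (i + p) p = w" using h by (metis factor_eq_iff square_at_def)
  then have "trib_prefix n = trib_prefix i @ (w @ w) @ factor (i + p + p) (n - i - 2 * p)"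
    using h(3) by (subst n) (simp add: trib_prefix_add factor_add)
  moreover have "w \<noteq> []" using h by (auto simp: square_at_def simp flip: length_greater_0_conv)
  ultimately show "w \<noteq> [] \<and> sublist (w @ w) (trib_prefix n)"
    by (metis sublist_appendI)
qed

lemma strict_mono_block_start_funpow: "strict_mono (block_start ^^ s)"
  by (induction s) (auto simp: strict_mono_def)

definition first_end :: "nat \<times> letter \<times> nat \<Rightarrow> nat" where
  "first_end = (\<lambda>(s, x, e). (block_start ^^ s) (first_index x) + e + 2 * image_length s x)"

definition square_base :: "nat \<times> letter \<times> nat \<Rightarrow> letter list" where
  "square_base = (\<lambda>(s, x, e). factor e (image_length s x))"

text \<open>Every root occurring in \<open>T\<close> has exactly one index: offsets are reduced modulo the period, and
  as \<open>\<sigma>\<^sup>s(c) = \<sigma>\<^bsup>s-1\<^esup>(a)\<close>, a root arising from both \<open>c\<close> and \<open>a\<close> is attributed to \<open>a\<close>, where it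
  occurs earlier.\<close>

definition indices :: "(nat \<times> letter \<times> nat) set" where
  "indices = {(s, x, e). e + image_length s x \<le> overlap s \<and> e < image_length s x
     \<and> (x = Lc \<longrightarrow> overlap (s - 1) < e + image_length s x)}"

text \<open>All positions P^s(j) share their first H_s letters, so the root depends only on s, x and
  e, and the first position carrying x gives the earliest end.\<close>

lemma trib_square_iff_offset:
  "w \<noteq> [] \<and> sublist (w @ w) (trib_prefix n) \<longleftrightarrow>
    (\<exists>s x e. e + image_length s x \<le> overlap s \<and> first_end (s, x, e) \<le> n \<and> w = square_base (s, x, e))"
  (is "?L \<longleftrightarrow> ?R")
proof -
  have w: "factor ((block_start ^^ s) j + e) p = factor e p" if "e + p \<le> overlap s" for s j e p
    using agree_shift[OF agree_mono[OF agree_block_start_funpow that], of j] by (simp add: factor_eq_iff)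
  show ?thesis
  proof
    assume ?L
    then obtain i p where h: "square_at i p" "i + 2 * p \<le> n" "w = factor i p"
      using trib_square_iff by blast
    then obtain s j e where
      j: "i = (block_start ^^ s) j + e" "p = image_length s (trib_word j)" "e + p \<le> overlap s"
      using square_at_iff by blast
    have "(block_start ^^ s) (first_index (trib_word j)) \<le> (block_start ^^ s) j"
      using first_index_le by (simp add: strict_mono_less_eq[OF strict_mono_block_start_funpow])
    then have "first_end (s, trib_word j, e) \<le> n" using h j by (simp add: first_end_def)
    moreover have "w = square_base (s, trib_word j, e)" using h j w by (simp add: square_base_def)
    ultimately show ?R using j by blast
  next
    assume ?R
    then obtain s x e where
      h: "e + image_length s x \<le> overlap s" "first_end (s, x, e) \<le> n" "w = square_base (s, x, e)" by blast
    let ?i = "(block_start ^^ s) (first_index x) + e" and ?p = "image_length s x"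
    have "square_at ?i ?p"
      unfolding square_at_iff using h(1) by (metis trib_word_first_index)
    moreover have "?i + 2 * ?p \<le> n" using h by (simp add: first_end_def)
    moreover have "w = factor ?i ?p" using h w by (simp add: square_base_def)
    ultimately show ?L using trib_square_iff by blast
  qed
qed


section \<open>Tribonacci estimates and reduction to unique indices\<close>

lemma trib_shift_rec: "trib_shift (n + 3) = trib_shift (n + 2) + trib_shift (n + 1) + trib_shift n"
  by (simp add: numeral_3_eq_3)

lemma trib_shift_Suc_mono: "trib_shift n \<le> trib_shift (Suc n)"
proof (cases n rule: trib_shift.cases)
  case (4 k)
  then show ?thesis by simp
qed simp_all

lemma trib_shift_mono: "m \<le> n \<Longrightarrow> trib_shift m \<le> trib_shift n"
  by (rule lift_Suc_mono_le[of trib_shift, OF trib_shift_Suc_mono])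

lemma strict_mono_trib_shift: "strict_mono (\<lambda>n. trib_shift (n + 2))"
proof (rule strict_mono_Suc_iff[THEN iffD2], rule allI)
  fix n
  show "trib_shift (n + 2) < trib_shift (Suc n + 2)"
    using trib_shift_rec[of n] trib_shift_pos[of n] by (simp add: numeral_3_eq_3 numeral_2_eq_2)
qed

text \<open>The closed form (t_(n+1) + t_(n-1) - 3) / 2 of H_n, the source of the half in
  \<theta>.\<close>

lemma two_overlap: "2 * overlap n + 3 = trib_shift (n + 3) + trib_shift (n + 1)"
  by (induction n) (auto simp: numeral_3_eq_3 numeral_2_eq_2)

lemma trib_shift_le_overlap: "trib_shift (n + 2) \<le> Suc (overlap n)"
proof (induction n)
  case (Suc n)
  have "trib_shift (n + 1) + trib_shift n \<le> Suc (overlap n)"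
  proof (cases n)
    case (Suc k)
    then show ?thesis
      using \<open>trib_shift (n + 2) \<le> Suc (overlap n)\<close> two_overlap[of n] trib_shift_Suc_mono[of k]
        trib_shift_Suc_mono[of n] trib_shift_pos[of n] trib_shift_pos[of k]
      by (simp add: numeral_3_eq_3 numeral_2_eq_2)
  qed simp
  then show ?case by (simp add: numeral_2_eq_2)
qed simp

text \<open>With the two bounds that follow, the offset e of a square lies below the period for a
  and b, and below twice the period for c.\<close>

lemma overlap_less_La: "overlap s < 2 * image_length s La"
  using two_overlap[of s] trib_shift_Suc_mono[of s] trib_shift_Suc_mono[of "Suc s"]
  by (simp add: numeral_3_eq_3 numeral_2_eq_2)

lemma overlap_less_Lb: "overlap s < 2 * image_length s Lb"
proof (cases s)
  case (Suc k)
  then show ?thesis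
    using two_overlap[of s] trib_shift_Suc_mono[of k] trib_shift_Suc_mono[of "Suc k"]
    by (simp add: numeral_3_eq_3 numeral_2_eq_2)
qed simp

lemma overlap_less_Lc: "overlap s < 3 * image_length s Lc"
proof (cases s)
  case (Suc k)
  then show ?thesis
    using two_overlap[of s] trib_shift_Suc_mono[of k] trib_shift_Suc_mono[of "Suc k"]
    by (simp add: numeral_3_eq_3 numeral_2_eq_2)
qed simp

text \<open>Only c requires work: one subtraction of the period brings the offset below it, and if
  the root then fits into \<open>overlap (s - 1)\<close>, it comes from a at level s - 1 with an
  earlier end.\<close>

lemma square_base_reduce:
  assumes "e + image_length s x \<le> overlap s"
  obtains z where "z \<in> indices" "first_end z \<le> first_end (s, x, e)" "square_base z = square_base (s, x, e)"
proof (cases x)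
  case La
  then show thesis using assms overlap_less_La[of s] that[of "(s, x, e)"] by (auto simp: indices_def)
next
  case Lb
  then show thesis using assms overlap_less_Lb[of s] that[of "(s, x, e)"] by (auto simp: indices_def)
next
  case Lc
  let ?p = "image_length s Lc"
  obtain e' where e': "e' < ?p" "e' \<le> e" "e' + ?p \<le> overlap s" "factor e' ?p = factor e ?p"
  proof (cases "e < ?p")
    case True
    then show thesis using that[of e] assms Lc by simp
  next
    case False
    then have "agree (e - ?p) (e - ?p + ?p) ?p" using assms Lc by (intro agree_period) simp
    then have "factor (e - ?p) ?p = factor e ?p" using False by (simp add: factor_eq_iff)
    moreover have "e - ?p < ?p"
      using assms[unfolded Lc] overlap_less_Lc[of s] False by linarith
    moreover have "e - ?p + ?p \<le> overlap s" using assms[unfolded Lc] False by linarith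
    ultimately show thesis using that[of "e - ?p"] by simp
  qed
  show thesis
  proof (cases "overlap (s - 1) < e' + ?p")
    case True
    then have "(s, Lc, e') \<in> indices" using e' by (simp add: indices_def)
    then show thesis using that Lc e' by (simp add: first_end_def square_base_def)
  next
    case False
    have "s \<noteq> 0" by (rule notI) (use e' in simp)
    then obtain k where k: "s = Suc k" by (cases s) auto
    then have "image_length k La = ?p" by (simp add: numeral_2_eq_2)
    then have "(k, La, e') \<in> indices" "square_base (k, La, e') = factor e' ?p"
      "first_end (k, La, e') \<le> first_end (s, x, e)"
      using False e' Lc k by (auto simp: indices_def square_base_def first_end_def simp del: image_length.simps)
    then show thesis using that Lc e' by (simp add: square_base_def)
  qed
qed

lemma trib_squares_eq:
  "{w. w \<noteq> [] \<and> sublist (w @ w) (trib_prefix n)} = square_base ` {z \<in> indices. first_end z \<le> n}"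
proof (intro equalityI subsetI)
  fix w assume "w \<in> {w. w \<noteq> [] \<and> sublist (w @ w) (trib_prefix n)}"
  then obtain s x e where
    h: "e + image_length s x \<le> overlap s" "first_end (s, x, e) \<le> n" "w = square_base (s, x, e)"
    using trib_square_iff_offset[of w n] by auto
  then obtain z where "z \<in> indices" "first_end z \<le> first_end (s, x, e)" "square_base z = w"
    using square_base_reduce by metis
  then show "w \<in> square_base ` {z \<in> indices. first_end z \<le> n}" using h(2) by force
next
  fix w assume "w \<in> square_base ` {z \<in> indices. first_end z \<le> n}"
  then obtain s x e where "(s, x, e) \<in> indices" "first_end (s, x, e) \<le> n" "w = square_base (s, x, e)"
    by auto
  then have "w \<noteq> [] \<and> sublist (w @ w) (trib_prefix n)"
    unfolding trib_square_iff_offset by (auto simp: indices_def)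
  then show "w \<in> {w. w \<noteq> [] \<and> sublist (w @ w) (trib_prefix n)}" by simp
qed

text \<open>Levels 0 and 1 are too short for a square from a. The inequality is arranged so that its
  left side is the corresponding \<open>first_end\<close>.\<close>

lemma indices_La: "(s, La, e) \<in> indices \<longleftrightarrow>
    (\<exists>k. s = k + 2 \<and> 2 * trib_shift (k + 4) + e \<le> trib_shift (k + 5) + overlap k)"
proof (cases "s < 2")
  case True
  then have "s = 0 \<or> s = 1" by auto
  then show ?thesis by (auto simp: indices_def numeral_2_eq_2)
next
  case False
  then obtain k where k: "s = k + 2" using le_Suc_ex[of 2 s] by (auto simp: add.commute)
  have "overlap s = overlap k + trib_shift (k + 2) + trib_shift (k + 3)"
    by (simp add: k numeral_2_eq_2 numeral_3_eq_3)
  moreover have "trib_shift (k + 5) = trib_shift (k + 4) + trib_shift (k + 3) + trib_shift (k + 2)"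
    by (simp add: eval_nat_numeral)
  moreover have "image_length s La = trib_shift (k + 4)" by (simp add: k eval_nat_numeral)
  ultimately have "2 * trib_shift (k + 4) + e \<le> trib_shift (k + 5) + overlap k \<longleftrightarrow>
      e + image_length s La \<le> overlap s" by linarith
  then show ?thesis using overlap_less_La[of s] k by (auto simp: indices_def)
qed

lemma indices_Lb: "(s, Lb, e) \<in> indices \<longleftrightarrow> (\<exists>k. s = k + 2 \<and> e \<le> overlap k)"
proof (cases "s < 2")
  case True
  then have "s = 0 \<or> s = 1" by auto
  then show ?thesis by (auto simp: indices_def numeral_2_eq_2)
next
  case False
  then obtain k where k: "s = k + 2" using le_Suc_ex[of 2 s] by (auto simp: add.commute)
  have "overlap s = overlap k + trib_shift (k + 2) + trib_shift (k + 3)"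
    by (simp add: k numeral_2_eq_2 numeral_3_eq_3)
  moreover have "image_length s Lb = trib_shift (k + 3) + trib_shift (k + 2)"
    by (simp add: k numeral_2_eq_2 numeral_3_eq_3)
  ultimately have "e \<le> overlap k \<longleftrightarrow> e + image_length s Lb \<le> overlap s" by linarith
  then show ?thesis using overlap_less_Lb[of s] k by (auto simp: indices_def)
qed

lemma indices_Lc: "(s, Lc, e) \<in> indices \<longleftrightarrow>
    (\<exists>k. s = k + 1 \<and> e < trib_shift (k + 2) \<and> overlap k < e + trib_shift (k + 2))"
proof (cases s)
  case 0
  then show ?thesis by (auto simp: indices_def)
next
  case (Suc k)
  then have "image_length s Lc = trib_shift (k + 2)" by (simp add: numeral_2_eq_2)
  then show ?thesis using trib_shift_le_overlap[of k] Suc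
    by (auto simp: indices_def simp del: image_length.simps)
qed

lemma first_end_La: "first_end (k + 2, La, e) = 2 * trib_shift (k + 4) + e"
  by (simp add: first_end_def eval_nat_numeral del: funpow.simps)

lemma first_end_Lb:
  "first_end (k + 2, Lb, e) = trib_shift (k + 5) + trib_shift (k + 3) + trib_shift (k + 2) + e"
  using block_start_funpow_1[of "k + 2"]
  by (simp add: first_end_def numeral_2_eq_2 numeral_3_eq_3 eval_nat_numeral del: funpow.simps)

lemma first_end_Lc: "first_end (k + 1, Lc, e) = trib_shift (k + 5) + trib_shift (k + 2) + e"
proof -
  let ?B = "block_start ^^ (k + 1)"
  have "?B 3 = ?B 0 + image_length (k + 1) La + image_length (k + 1) Lb + image_length (k + 1) La"
    unfolding numeral_3_eq_3 block_start_funpow_Suc by (simp only: trib_word_0 trib_word_1 trib_word_2)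
  then have "?B 3 = 2 * trib_shift (k + 3) + trib_shift (k + 2) + trib_shift (k + 1)"
    by (simp add: numeral_2_eq_2 numeral_3_eq_3 del: funpow.simps)
  then show ?thesis
    by (simp add: first_end_def eval_nat_numeral del: funpow.simps)
qed


lemma indices_cases:
  assumes "z \<in> indices"
  obtains (La) k e where "z = (k + 2, La, e)" "2 * trib_shift (k + 4) + e \<le> trib_shift (k + 5) + overlap k"
  | (Lb) k e where "z = (k + 2, Lb, e)" "e \<le> overlap k"
  | (Lc) k e where "z = (k + 1, Lc, e)" "e < trib_shift (k + 2)" "overlap k < e + trib_shift (k + 2)"
proof -
  obtain s x e where z: "z = (s, x, e)" by (cases z)
  show thesis
    using assms La Lb Lc indices_La[of s e] indices_Lb[of s e] indices_Lc[of s e]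
    unfolding z by (cases x) blast+
qed

section \<open>Separating the roots by period and offset\<close>

lemma trib_shift_eq_iff: "trib_shift (m + 2) = trib_shift (n + 2) \<longleftrightarrow> m = n"
  by (rule strict_mono_eq[OF strict_mono_trib_shift])

lemma trib_shift_le_iff: "trib_shift (m + 2) \<le> trib_shift (n + 2) \<longleftrightarrow> m \<le> n"
  by (rule strict_mono_less_eq[OF strict_mono_trib_shift])

text \<open>The sum lies strictly between t_(k+1) and t_(k+2). Hence periods from b never equal
  those from a or c.\<close>

lemma trib_shift_neq_add: "trib_shift (n + 2) \<noteq> trib_shift (k + 3) + trib_shift (k + 2)"
proof
  assume eq: "trib_shift (n + 2) = trib_shift (k + 3) + trib_shift (k + 2)"
  have "trib_shift (k + 2 + 2) = trib_shift (k + 3) + trib_shift (k + 2) + trib_shift (k + 1)"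
    by (simp add: eval_nat_numeral)
  moreover have "0 < trib_shift (k + 1)" "0 < trib_shift (k + 2)"
    using trib_shift_pos[of k] trib_shift_pos[of "Suc k"] by (simp_all add: numeral_2_eq_2 del: trib_shift.simps)
  ultimately have "trib_shift (n + 2) < trib_shift (k + 2 + 2)" "trib_shift (k + 1 + 2) < trib_shift (n + 2)"
    using eq by (simp_all add: numeral_3_eq_3 numeral_2_eq_2 del: trib_shift.simps)
  then have "n < k + 2" "k + 1 < n"
    using trib_shift_le_iff[of "k + 2" n] trib_shift_le_iff[of n "k + 1"] by linarith+
  then show False by simp
qed

lemma image_length_Lb_neq:
  assumes "(s, Lb, e) \<in> indices" "(s', x, e') \<in> indices" "x \<noteq> Lb"
  shows "image_length s Lb \<noteq> image_length s' x"
proof -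
  obtain k where k: "s = k + 2" using assms(1) indices_Lb by blast
  have "\<exists>n. image_length s' x = trib_shift (n + 2)"
  proof (cases x)
    case La
    then show ?thesis by auto
  next
    case Lc
    then obtain n where "s' = n + 1" using assms(2) indices_Lc by blast
    with Lc show ?thesis by (intro exI[of _ n]) (simp add: numeral_2_eq_2)
  qed (use assms in simp)
  moreover have "image_length s Lb = trib_shift (k + 3) + trib_shift (k + 2)"
    by (simp add: k numeral_3_eq_3)
  ultimately show ?thesis using trib_shift_neq_add by metis
qed

text \<open>Equal lengths force s' = s + 1, and primitivity forces equal offsets; the root would
  then have to both fit into \<open>overlap s\<close> and exceed it.\<close>

lemma square_base_La_Lc:
  assumes "(s, La, e) \<in> indices" "(s', Lc, e') \<in> indices"
  shows "square_base (s, La, e) \<noteq> square_base (s', Lc, e')"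
proof
  assume eq: "square_base (s, La, e) = square_base (s', Lc, e')"
  obtain k where k: "s' = k + 1" using assms indices_Lc by blast
  have "length (square_base (s, La, e)) = length (square_base (s', Lc, e'))" using eq by simp
  then have "trib_shift (s + 2) = trib_shift (k + 2)" using k by (simp add: square_base_def)
  then have s: "s = k" by (simp only: trib_shift_eq_iff)
  then have p: "image_length s La = image_length s' Lc" using k by (simp add: numeral_2_eq_2)
  have "e = e'"
  proof (rule factor_period_inj)
    show "factor e (image_length s' Lc) = factor e' (image_length s' Lc)"
      using eq p by (simp add: square_base_def del: image_length.simps)
    show "e < image_length s' Lc" "e + image_length s' Lc \<le> overlap s'"
      "e' < image_length s' Lc" "e' + image_length s' Lc \<le> overlap s'"
      using assms p s k by (auto simp: indices_def simp del: image_length.simps trib_shift.simps)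
  qed
  then show False using assms p s k by (auto simp: indices_def simp del: image_length.simps)
qed

lemma inj_on_square_base: "inj_on square_base indices"
proof (rule inj_onI)
  fix z z' assume zz: "z \<in> indices" "z' \<in> indices" and eq: "square_base z = square_base z'"
  obtain s x e s' x' e' where z: "z = (s, x, e)" "z' = (s', x', e')" by (cases z; cases z') auto
  have len: "image_length s x = image_length s' x'"
    using arg_cong[OF eq, of length] by (simp add: z square_base_def)
  have x: "x = x'"
  proof (rule ccontr)
    assume "x \<noteq> x'"
    then have "x = Lb \<or> x' = Lb \<or> (x = La \<and> x' = Lc) \<or> (x = Lc \<and> x' = La)"
      by (cases x; cases x') auto
    then show False
      using image_length_Lb_neq square_base_La_Lc zz eq len \<open>x \<noteq> x'\<close> unfolding z by metis
  qed
  have s: "s = s'"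
  proof (cases x)
    case La
    then have "trib_shift (s + 2) = trib_shift (s' + 2)" using len x by simp
    then show ?thesis by (simp only: trib_shift_eq_iff)
  next
    case Lb
    have "image_length m Lb < image_length n Lb" if "m < n" for m n
      using that
    proof (rule strict_mono_less[THEN iffD2, rotated])
      show "strict_mono (\<lambda>n. image_length n Lb)"
      proof (rule strict_mono_Suc_iff[THEN iffD2], rule allI)
        fix n
        show "image_length n Lb < image_length (Suc n) Lb"
          using trib_shift_Suc_mono[of "Suc n"] trib_shift_Suc_mono[of n] trib_shift_pos[of n]
          by (cases n) (auto simp: numeral_2_eq_2)
      qed
    qed
    then show ?thesis using len x Lb by (metis linorder_neqE_nat nat_neq_iff)
  next
    case Lc
    then obtain m n where mn: "s = m + 1" "s' = n + 1" using zz indices_Lc x unfolding z by blast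
    then have "trib_shift (m + 2) = trib_shift (n + 2)" using len x Lc by simp
    then show ?thesis using mn by (simp only: trib_shift_eq_iff)
  qed
  have "e = e'"
    using eq zz factor_period_inj[of e s x e'] unfolding z x[symmetric] s[symmetric]
    by (auto simp: indices_def square_base_def)
  then show "z = z'" using z x s by simp
qed

section \<open>Counting\<close>

text \<open>With \<open>m = k + 3\<close> these are the intervals \<open>[\<alpha>\<^sub>m, \<beta>\<^sub>m]\<close> and \<open>[\<gamma>\<^sub>m, \<theta>\<^sub>m]\<close>.\<close>

definition new_ends :: "nat \<Rightarrow> nat set" where
  "new_ends k = {2 * trib_shift (k + 4)..<trib_shift (k + 5) + 2 * trib_shift (k + 2)}
     \<union> {trib_shift (k + 5) + trib_shift (k + 3) + trib_shift (k + 2)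
        ..<trib_shift (k + 5) + trib_shift (k + 3) + trib_shift (k + 2) + overlap k + 1}"

lemma trib_shift_expand:
  "trib_shift (k + 3) = trib_shift k + trib_shift (k + 1) + trib_shift (k + 2)"
  "trib_shift (k + 4) = trib_shift k + 2 * trib_shift (k + 1) + 2 * trib_shift (k + 2)"
  "trib_shift (k + 5) = 2 * trib_shift k + 3 * trib_shift (k + 1) + 4 * trib_shift (k + 2)"
  by (simp_all add: eval_nat_numeral)

lemma trib_shift_bounds:
  "trib_shift k \<le> trib_shift (k + 1)" "trib_shift (k + 1) \<le> trib_shift (k + 2)" "0 < trib_shift (k + 1)"
  "trib_shift (k + 2) \<le> overlap k + 1"
  "2 * overlap k + 3 = trib_shift k + 2 * trib_shift (k + 1) + trib_shift (k + 2)"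
proof -
  show "trib_shift k \<le> trib_shift (k + 1)" "trib_shift (k + 1) \<le> trib_shift (k + 2)"
    by (rule trib_shift_mono, simp)+
  show "0 < trib_shift (k + 1)" using trib_shift_pos[of k] by (simp only: Suc_eq_plus1)
  show "trib_shift (k + 2) \<le> overlap k + 1"
    using trib_shift_le_overlap[of k] by (simp only: Suc_eq_plus1)
  show "2 * overlap k + 3 = trib_shift k + 2 * trib_shift (k + 1) + trib_shift (k + 2)"
    using two_overlap[of k] trib_shift_expand(1)[of k] by linarith
qed

lemma new_ends_bounds: "new_ends k \<subseteq> {2 * trib_shift (k + 4)..<2 * trib_shift (k + 5)}"
proof
  fix n assume "n \<in> new_ends k"
  then show "n \<in> {2 * trib_shift (k + 4)..<2 * trib_shift (k + 5)}"
    using trib_shift_bounds[of k] trib_shift_expand[of k]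
    unfolding new_ends_def Un_iff atLeastLessThan_iff by linarith
qed

text \<open>With m = k + 3, the first interval is cut at t_m + H_k: ends up to there belong to a,
  later ones to c. The second interval belongs to b.\<close>

lemma first_end_indices: "first_end ` indices = (\<Union>k. new_ends k)"
proof (intro equalityI subsetI)
  fix n assume "n \<in> first_end ` indices"
  then obtain z where z: "z \<in> indices" "n = first_end z" by blast
  from z(1) show "n \<in> (\<Union>k. new_ends k)"
  proof (cases rule: indices_cases)
    case (La k e)
    have "n \<in> new_ends k"
      unfolding z(2) La(1) first_end_La new_ends_def
      using La trib_shift_bounds[of k] trib_shift_expand[of k] by auto
    then show ?thesis by blast
  next
    case (Lb k e)
    have "n \<in> new_ends k"
      unfolding z(2) Lb(1) first_end_Lb new_ends_def using Lb by auto
    then show ?thesis by blast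
  next
    case (Lc k e)
    have "n \<in> new_ends k"
      unfolding z(2) Lc(1) first_end_Lc new_ends_def
      using Lc trib_shift_bounds[of k] trib_shift_expand[of k] by auto
    then show ?thesis by blast
  qed
next
  fix n assume "n \<in> (\<Union>k. new_ends k)"
  then obtain k where "n \<in> new_ends k" by blast
  then consider
      "2 * trib_shift (k + 4) \<le> n" "n \<le> trib_shift (k + 5) + overlap k"
    | "trib_shift (k + 5) + overlap k < n" "n < trib_shift (k + 5) + 2 * trib_shift (k + 2)"
    | "trib_shift (k + 5) + trib_shift (k + 3) + trib_shift (k + 2) \<le> n"
      "n \<le> trib_shift (k + 5) + trib_shift (k + 3) + trib_shift (k + 2) + overlap k"
    by (cases "n \<le> trib_shift (k + 5) + overlap k") (auto simp: new_ends_def)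
  then show "n \<in> first_end ` indices"
  proof cases
    case 1
    then have "n = first_end (k + 2, La, n - 2 * trib_shift (k + 4))" unfolding first_end_La by simp
    moreover have "(k + 2, La, n - 2 * trib_shift (k + 4)) \<in> indices" using 1 by (auto simp: indices_La)
    ultimately show ?thesis by blast
  next
    case 2
    let ?e = "n - (trib_shift (k + 5) + trib_shift (k + 2))"
    have "trib_shift (k + 5) + trib_shift (k + 2) \<le> n" using 2 trib_shift_bounds(4)[of k] by linarith
    then have "n = first_end (k + 1, Lc, ?e)" "(k + 1, Lc, ?e) \<in> indices"
      using 2 unfolding first_end_Lc indices_Lc by auto
    then show ?thesis by blast
  next
    case 3
    let ?e = "n - (trib_shift (k + 5) + trib_shift (k + 3) + trib_shift (k + 2))"
    have "n = first_end (k + 2, Lb, ?e)" "(k + 2, Lb, ?e) \<in> indices"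
      using 3 unfolding first_end_Lb indices_Lb by auto
    then show ?thesis by blast
  qed
qed

lemma trib_interval_unique:
  assumes "2 * trib_shift (k + 4) \<le> n" "n < 2 * trib_shift (k + 5)"
    and "2 * trib_shift (k' + 4) \<le> n" "n < 2 * trib_shift (k' + 5)"
  shows "k = k'"
proof -
  have "\<not> k < k'" "\<not> k' < k"
    using trib_shift_mono[of "k + 5" "k' + 4"] trib_shift_mono[of "k' + 5" "k + 4"] assms by linarith+
  then show ?thesis by simp
qed

text \<open>Relates an index to its end \<open>n\<close> and to the level k of the interval
  containing \<open>n\<close>, which is s - 2 for a and b but s - 1 for c.\<close>

definition level_index :: "nat \<Rightarrow> nat \<Rightarrow> nat \<times> letter \<times> nat \<Rightarrow> bool" where
  "level_index k n z \<longleftrightarrow>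
    (\<exists>e. z = (k + 2, La, e) \<and> n = 2 * trib_shift (k + 4) + e \<and> n \<le> trib_shift (k + 5) + overlap k)
    \<or> (\<exists>e. z = (k + 1, Lc, e) \<and> n = trib_shift (k + 5) + trib_shift (k + 2) + e
        \<and> trib_shift (k + 5) + overlap k < n \<and> n < trib_shift (k + 5) + 2 * trib_shift (k + 2))
    \<or> (\<exists>e. z = (k + 2, Lb, e) \<and> n = trib_shift (k + 5) + trib_shift (k + 3) + trib_shift (k + 2) + e
        \<and> e \<le> overlap k)"

lemma level_index_exists:
  assumes "z \<in> indices"
  obtains k where "level_index k (first_end z) z"
  using assms
proof (cases rule: indices_cases)
  case (La k e)
  have "level_index k (first_end z) z"
    unfolding La(1) first_end_La level_index_def using La(2) by blast
  then show thesis by (rule that)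
next
  case (Lb k e)
  have "level_index k (first_end z) z"
    unfolding Lb(1) first_end_Lb level_index_def using Lb(2) by blast
  then show thesis by (rule that)
next
  case (Lc k e)
  have "trib_shift (k + 5) + overlap k < trib_shift (k + 5) + trib_shift (k + 2) + e"
    "trib_shift (k + 5) + trib_shift (k + 2) + e < trib_shift (k + 5) + 2 * trib_shift (k + 2)"
    using Lc by simp_all
  then have "level_index k (first_end z) z"
    unfolding Lc(1) first_end_Lc level_index_def by blast
  then show thesis by (rule that)
qed

lemma level_index_bounds:
  assumes "level_index k n z"
  shows "2 * trib_shift (k + 4) \<le> n" "n < 2 * trib_shift (k + 5)"
proof -
  have "2 * trib_shift (k + 4) \<le> n \<and> n \<le> trib_shift (k + 5) + overlap k
      \<or> trib_shift (k + 5) + overlap k < n \<and> n < trib_shift (k + 5) + 2 * trib_shift (k + 2)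
      \<or> trib_shift (k + 5) + trib_shift (k + 3) + trib_shift (k + 2) \<le> n
        \<and> n \<le> trib_shift (k + 5) + trib_shift (k + 3) + trib_shift (k + 2) + overlap k"
    using assms unfolding level_index_def by (elim disjE exE conjE) simp_all
  then show "2 * trib_shift (k + 4) \<le> n" "n < 2 * trib_shift (k + 5)"
    using trib_shift_bounds[of k] trib_shift_expand[of k] by linarith+
qed

text \<open>The three ranges of ends follow one another, so k and \<open>n\<close> decide the letter
  and then the offset.\<close>

lemma level_index_eq:
  assumes "level_index k n z"
  shows "z = (if n \<le> trib_shift (k + 5) + overlap k then (k + 2, La, n - 2 * trib_shift (k + 4))
    else if n < trib_shift (k + 5) + 2 * trib_shift (k + 2)
      then (k + 1, Lc, n - (trib_shift (k + 5) + trib_shift (k + 2)))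
    else (k + 2, Lb, n - (trib_shift (k + 5) + trib_shift (k + 3) + trib_shift (k + 2))))"
proof -
  have le: "trib_shift (k + 2) \<le> trib_shift (k + 3)" by (rule trib_shift_mono) simp
  have h: "overlap k < trib_shift (k + 3) + trib_shift (k + 2)"
    using trib_shift_bounds[of k] trib_shift_expand[of k] by linarith
  from assms consider
      (a) e where "z = (k + 2, La, e)" "n = 2 * trib_shift (k + 4) + e" "n \<le> trib_shift (k + 5) + overlap k"
    | (c) e where "z = (k + 1, Lc, e)" "n = trib_shift (k + 5) + trib_shift (k + 2) + e"
        "trib_shift (k + 5) + overlap k < n" "n < trib_shift (k + 5) + 2 * trib_shift (k + 2)"
    | (b) e where "z = (k + 2, Lb, e)" "n = trib_shift (k + 5) + trib_shift (k + 3) + trib_shift (k + 2) + e"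
    unfolding level_index_def by blast
  then show ?thesis
  proof cases
    case a
    then have "n - 2 * trib_shift (k + 4) = e" by linarith
    with a show ?thesis by (simp only: if_True)
  next
    case c
    then have "n - (trib_shift (k + 5) + trib_shift (k + 2)) = e"
      and "\<not> n \<le> trib_shift (k + 5) + overlap k" by linarith+
    with c show ?thesis by (simp only: if_True if_False)
  next
    case b
    then have "n - (trib_shift (k + 5) + trib_shift (k + 3) + trib_shift (k + 2)) = e"
      and "\<not> n \<le> trib_shift (k + 5) + overlap k"
      and "\<not> n < trib_shift (k + 5) + 2 * trib_shift (k + 2)" using le h by linarith+
    with b(1) show ?thesis by (simp only: if_False)
  qed
qed

lemma inj_on_first_end: "inj_on first_end indices"
proof (rule inj_onI)
  fix z z' assume zz: "z \<in> indices" "z' \<in> indices" and eq: "first_end z = first_end z'"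
  obtain k where k: "level_index k (first_end z) z" using zz(1) by (rule level_index_exists)
  obtain k' where k': "level_index k' (first_end z) z'"
    using zz(2) by (rule level_index_exists) (simp add: eq)
  have "k = k'"
    using level_index_bounds[OF k] level_index_bounds[OF k'] by (rule trib_interval_unique)
  with k' have k'': "level_index k (first_end z) z'" by simp
  show "z = z'" by (rule trans[OF level_index_eq[OF k] level_index_eq[OF k'', symmetric]])
qed

text \<open>Distinct roots have distinct indices and distinct first ends, so counting roots amounts
  to counting ends up to n.\<close>

lemma A_count_eq: "A_count n = card ((\<Union>k. new_ends k) \<inter> {..n})"
proof -
  let ?I = "{z \<in> indices. first_end z \<le> n}"
  have "A_count n = card (square_base ` ?I)"
    unfolding A_count_def trib_squares_eq ..
  also have "\<dots> = card ?I"
    by (rule card_image) (rule inj_on_subset[OF inj_on_square_base], blast)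
  also have "\<dots> = card (first_end ` ?I)"
    by (rule card_image[symmetric]) (rule inj_on_subset[OF inj_on_first_end], blast)
  also have "first_end ` ?I = (\<Union>k. new_ends k) \<inter> {..n}"
    unfolding first_end_indices[symmetric] by auto
  finally show ?thesis .
qed

lemma finite_new_ends [simp]: "finite (new_ends k)"
  by (simp add: new_ends_def)

lemma new_ends_below:
  assumes "j < k"
  shows "new_ends j \<subseteq> {..<2 * trib_shift (k + 4)}"
proof -
  have "trib_shift (j + 5) \<le> trib_shift (k + 4)" using assms by (intro trib_shift_mono) simp
  then have "{2 * trib_shift (j + 4)..<2 * trib_shift (j + 5)} \<subseteq> {..<2 * trib_shift (k + 4)}" by auto
  then show ?thesis using new_ends_bounds[of j] by (rule order_trans[rotated])
qed

lemma card_new_ends_Int_atMost: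
  "card (new_ends k \<inter> {..n}) =
    (min (n + 1) (trib_shift (k + 5) + 2 * trib_shift (k + 2)) - 2 * trib_shift (k + 4))
    + (min (n + 1) (trib_shift (k + 5) + trib_shift (k + 3) + trib_shift (k + 2) + overlap k + 1)
       - (trib_shift (k + 5) + trib_shift (k + 3) + trib_shift (k + 2)))"
proof -
  have cut: "{a..<b} \<inter> {..n} = {a..<min (n + 1) b}" for a b by auto
  show ?thesis
    unfolding new_ends_def Int_Un_distrib2 cut
    by (subst card_Un_disjoint) (use trib_shift_expand[of k] in auto)
qed

text \<open>The total over all completed levels, by summing the interval lengths; it is doubled and
  kept additive to stay within the naturals.\<close>

lemma card_new_ends_less:
  "2 * card (\<Union>j<k. new_ends j) + trib_shift (k + 5) + trib_shift (k + 2) + k + 8 = 4 * trib_shift (k + 4)"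
proof (induction k)
  case 0
  then show ?case by (simp add: eval_nat_numeral)
next
  case (Suc k)
  have "(\<Union>j<Suc k. new_ends j) = (\<Union>j<k. new_ends j) \<union> new_ends k"
    by (auto simp: lessThan_Suc)
  moreover have "(\<Union>j<k. new_ends j) \<inter> new_ends k = {}"
    using new_ends_below[of _ k] new_ends_bounds[of k] by fastforce
  ultimately have c: "card (\<Union>j<Suc k. new_ends j) = card (\<Union>j<k. new_ends j) + card (new_ends k)"
    by (simp add: card_Un_disjoint)
  have "new_ends k = new_ends k \<inter> {..2 * trib_shift (k + 5)}"
    using new_ends_bounds[of k] by auto
  then have "card (new_ends k) = card (new_ends k \<inter> {..2 * trib_shift (k + 5)})" by simp
  then have n: "card (new_ends k) + trib_shift (k + 1) = 2 * trib_shift (k + 2) + overlap k + 1"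
    unfolding card_new_ends_Int_atMost using trib_shift_bounds[of k] trib_shift_expand[of k] by auto
  have "trib_shift (Suc k + 2) = trib_shift (k + 3)" "trib_shift (Suc k + 4) = trib_shift (k + 5)"
    "trib_shift (Suc k + 5) = trib_shift (k + 5) + trib_shift (k + 4) + trib_shift (k + 3)"
    by (simp_all add: eval_nat_numeral)
  then show ?case
    using c n Suc.IH trib_shift_bounds[of k] trib_shift_expand[of k] by linarith
qed

lemma A_count_interval:
  assumes "2 * trib_shift (k + 4) \<le> n" "n < 2 * trib_shift (k + 5)"
  shows "A_count n = card (\<Union>j<k. new_ends j) + card (new_ends k \<inter> {..n})"
proof -
  have "(\<Union>j. new_ends j) \<inter> {..n} = (\<Union>j<k. new_ends j) \<union> (new_ends k \<inter> {..n})" (is "?L = ?R")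
  proof (intro equalityI subsetI)
    fix i assume "i \<in> ?L"
    then obtain j where j: "i \<in> new_ends j" "i \<le> n" by auto
    have "\<not> k < j"
    proof
      assume "k < j"
      then have "trib_shift (k + 5) \<le> trib_shift (j + 4)" by (intro trib_shift_mono) simp
      then show False using j new_ends_bounds[of j] assms by force
    qed
    then have "j < k \<or> j = k" by auto
    then show "i \<in> ?R" using j by auto
  next
    fix i assume "i \<in> ?R"
    moreover have "i \<le> n" if "i \<in> new_ends j" "j < k" for j
      using that new_ends_below[of j k] assms by force
    ultimately show "i \<in> ?L" by auto
  qed
  moreover have "(\<Union>j<k. new_ends j) \<inter> (new_ends k \<inter> {..n}) = {}"
    using new_ends_below[of _ k] new_ends_bounds[of k] by fastforce
  ultimately show ?thesis by (simp add: A_count_eq card_Un_disjoint)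
qed

lemma A_count_initial: "n < 8 \<Longrightarrow> A_count n = 0"
proof -
  assume n: "n < 8"
  have "new_ends k \<inter> {..n} = {}" for k
    using new_ends_bounds[of k] trib_shift_mono[of 4 "k + 4"] n by (force simp: eval_nat_numeral)
  then have "(\<Union>k. new_ends k) \<inter> {..n} = {}" by blast
  then show ?thesis by (simp add: A_count_eq)
qed

section \<open>Evaluation of the count in terms of t\<close>

lemma t_eq: "i + 2 = int n \<Longrightarrow> t i = int (trib_shift n)"
  by (simp add: t_def)

lemma alpha_eq: "alpha (k + 3) = int (2 * trib_shift (k + 4))"
  "alpha (Suc (k + 3)) = int (2 * trib_shift (k + 5))"
  using t_eq[of "int (k + 3) - 1" "k + 4"] t_eq[of "int (Suc (k + 3)) - 1" "k + 5"]
  by (simp_all add: alpha_def)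

lemma trib_interval_exists:
  assumes "8 \<le> n"
  obtains k where "2 * trib_shift (k + 4) \<le> n" "n < 2 * trib_shift (k + 5)"
proof -
  have "n + 3 \<le> trib_shift (n + 5)"
    using strict_mono_imp_increasing[OF strict_mono_trib_shift, of "n + 3"] by (simp add: add.commute)
  then have "n < 2 * trib_shift (n + 5)" by simp
  then have ex: "\<exists>k. n < 2 * trib_shift (k + 5)" ..
  define k where "k = (LEAST k. n < 2 * trib_shift (k + 5))"
  have "n < 2 * trib_shift (k + 5)" unfolding k_def using ex by (rule LeastI_ex)
  moreover have "2 * trib_shift (k + 4) \<le> n"
  proof (cases k)
    case 0
    then show ?thesis using assms by (simp add: eval_nat_numeral)
  next
    case (Suc j)
    then have "j < k" by simp
    then have "\<not> n < 2 * trib_shift (j + 5)" unfolding k_def by (rule not_less_Least)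
    moreover have "k + 4 = j + 5" using Suc by simp
    ultimately show ?thesis by (simp only: not_less)
  qed
  ultimately show thesis using that by blast
qed

theorem theoremA:
  shows "(\<forall>n. 1 \<le> n \<and> n \<le> 7 \<longrightarrow> A_count n = 0)
    \<and> A_count 8 = 1 \<and> A_count 9 = 1
    \<and> (\<forall>n. 10 \<le> n \<and> n \<le> 13 \<longrightarrow> A_count n = 2)
    \<and> (\<forall>n::nat. n \<ge> 14 \<longrightarrow>
         (\<exists>m. alpha m \<le> int n \<and> int n < alpha (Suc m)) \<and>
         (\<forall>m. alpha m \<le> int n \<and> int n < alpha (Suc m) \<longrightarrow>
            m \<ge> 4 \<and>
            (alpha m \<le> int n \<and> int n < beta m \<longrightarrow>
               real (A_count n) = real n - (t m + t (int m - 3) + m + 3) / 2) \<and>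
            (beta m \<le> int n \<and> int n < gamma m \<longrightarrow>
               real (A_count n) = (t (int m - 1) + t (int m - 2) + 4 * t (int m - 3) - m - 5) / 2) \<and>
            (gamma m \<le> int n \<and> real n < theta m \<longrightarrow>
               real (A_count n) = real n - (t (int m - 1) + 3 * t (int m - 2) + m + 3) / 2) \<and>
            (theta m \<le> real n \<and> int n < alpha (Suc m) \<longrightarrow>
               real (A_count n) = (2 * t (int m - 1) + t (int m - 2) + 3 * t (int m - 3) - m - 6) / 2)))"
proof (intro conjI allI impI)
  show "A_count n = 0" if "1 \<le> n \<and> n \<le> 7" for n
    using that A_count_initial by simp
  \<comment> \<open>These n form level k = 0, whose new ends are 8 and 10.\<close>
  have small: "A_count n = (min (n + 1) 9 - 8) + (min (n + 1) 11 - 10)" if "8 \<le> n" "n < 14" for n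
    using A_count_interval[of 0 n] card_new_ends_Int_atMost[of 0 n] that
    by (simp add: eval_nat_numeral)
  show "A_count 8 = 1" "A_count 9 = 1" by (simp_all add: small)
  show "A_count n = 2" if "10 \<le> n \<and> n \<le> 13" for n
    using that by (simp add: small)
next
  fix n :: nat assume n: "14 \<le> n"
  obtain k where "2 * trib_shift (k + 4) \<le> n" "n < 2 * trib_shift (k + 5)"
    using trib_interval_exists[of n] n by auto
  then show "\<exists>m. alpha m \<le> int n \<and> int n < alpha (Suc m)"
    using alpha_eq[of k] by (intro exI[of _ "k + 3"]) simp
next
  fix n m :: nat assume n: "14 \<le> n" and m: "alpha m \<le> int n \<and> int n < alpha (Suc m)"
  show m4: "4 \<le> m"
  proof (rule ccontr)
    assume "\<not> 4 \<le> m"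
    \<comment> \<open>For m at most 3 the upper end \<alpha>_(m+1) is at most \<alpha>_4 =
      14.\<close>
    then have "trib_shift (m + 2) \<le> trib_shift 5" by (intro trib_shift_mono) simp
    then have "alpha (Suc m) \<le> 14"
      using t_eq[of "int m" "m + 2"] by (simp add: alpha_def eval_nat_numeral)
    then show False using n m by simp
  qed
  then obtain k where k: "m = k + 3" using le_Suc_ex[of 3 m] by (auto simp: add.commute)
  define K where "K = card (\<Union>j<k. new_ends j)"
  \<comment> \<open>All quantities become linear in a, b, c and h, that is t_(k-2), t_(k-1), t_k and
    H_k.\<close>
  define a where "a = trib_shift k"
  define b where "b = trib_shift (k + 1)"
  define c where "c = trib_shift (k + 2)"
  define h where "h = overlap k"
  have ts: "trib_shift (k + 3) = a + b + c" "trib_shift (k + 4) = a + 2 * b + 2 * c"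
    "trib_shift (k + 5) = 2 * a + 3 * b + 4 * c"
    unfolding a_def b_def c_def by (rule trib_shift_expand)+
  have bounds: "a \<le> b" "b \<le> c" "0 < b" "c \<le> h + 1" "2 * h + 3 = a + 2 * b + c"
    unfolding a_def b_def c_def h_def by (rule trib_shift_bounds)+
  have t: "t (int m) = int (2 * a + 3 * b + 4 * c)" "t (int m - 1) = int (a + 2 * b + 2 * c)"
    "t (int m - 2) = int (a + b + c)" "t (int m - 3) = int c"
    using t_eq[of "int m" "k + 5"] t_eq[of "int m - 1" "k + 4"] t_eq[of "int m - 2" "k + 3"]
      t_eq[of "int m - 3" "k + 2"] by (simp_all only: k ts c_def)
  have Sm: "alpha (Suc m) = int (2 * (2 * a + 3 * b + 4 * c))" by (simp add: alpha_def t)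
  have K: "2 * K + k + 8 = 2 * a + 5 * b + 3 * c"
    using card_new_ends_less[of k] unfolding ts K_def[symmetric] c_def[symmetric] by (simp add: distrib_left)
  have n1: "2 * a + 4 * b + 4 * c \<le> n" using m by (simp add: alpha_def t)
  have n2: "n < 4 * a + 6 * b + 8 * c" using m by (simp add: Sm)
  have A: "A_count n = K + ((min (n + 1) (2 * a + 3 * b + 6 * c) - (2 * a + 4 * b + 4 * c))
      + (min (n + 1) (3 * a + 4 * b + 6 * c + h + 1) - (3 * a + 4 * b + 6 * c)))"
    using A_count_interval[of k n] n1 n2
    unfolding ts card_new_ends_Int_atMost K_def[symmetric] c_def[symmetric] h_def[symmetric]
    by (simp add: algebra_simps)
  \<comment> \<open>This is \<gamma>_m + H_k, so \<theta>_m is an integer and the last new end of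
    the level.\<close>
  have theta: "theta m = real (3 * a + 4 * b + 6 * c + h)"
    using arg_cong[OF bounds(5), of real] by (simp add: theta_def t field_simps)
  show "real (A_count n) = real n - (t m + t (int m - 3) + m + 3) / 2"
    if "alpha m \<le> int n \<and> int n < beta m"
  proof -
    have "n + 1 < 2 * a + 3 * b + 6 * c" using that by (simp add: beta_def t)
    then have "A_count n = K + (n + 1 - (2 * a + 4 * b + 4 * c))" using A by simp
    \<comment> \<open>Subtractions are cleared in the naturals before passing to the reals.\<close>
    then have "2 * A_count n + (2 * a + 3 * b + 5 * c + k + 6) = 2 * n" using n1 K by linarith
    from arg_cong[OF this, of real] show ?thesis unfolding t by (simp add: k field_simps)
  qed
  show "real (A_count n) = (t (int m - 1) + t (int m - 2) + 4 * t (int m - 3) - m - 5) / 2"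
    if "beta m \<le> int n \<and> int n < gamma m"
  proof -
    \<comment> \<open>As \<beta>_m is the last element of the first interval, that interval is
      complete from n = \<beta>_m on, and the count is constant until \<gamma>_m.\<close>
    have "2 * a + 3 * b + 6 * c \<le> n + 1" "n < 3 * a + 4 * b + 6 * c"
      using that by (simp_all add: beta_def gamma_def t)
    then have "A_count n + b = K + 2 * c" using A bounds by simp
    then have "2 * A_count n + k + 8 = 2 * a + 3 * b + 7 * c" using K by linarith
    from arg_cong[OF this, of real] show ?thesis unfolding t by (simp add: k field_simps)
  qed
  show "real (A_count n) = real n - (t (int m - 1) + 3 * t (int m - 2) + m + 3) / 2"
    if "gamma m \<le> int n \<and> real n < theta m"
  proof -
    have "3 * a + 4 * b + 6 * c \<le> n" using that by (simp add: gamma_def t)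
    moreover have "n < 3 * a + 4 * b + 6 * c + h" using that unfolding theta of_nat_less_iff by simp
    ultimately have "A_count n + b + (3 * a + 4 * b + 6 * c) = K + 2 * c + n + 1"
      using A bounds by simp
    then have "2 * A_count n + (4 * a + 5 * b + 5 * c + k + 6) = 2 * n" using K by linarith
    from arg_cong[OF this, of real] show ?thesis unfolding t by (simp add: k field_simps)
  qed
  show "real (A_count n) = (2 * t (int m - 1) + t (int m - 2) + 3 * t (int m - 3) - m - 6) / 2"
    if "theta m \<le> real n \<and> int n < alpha (Suc m)"
  proof -
    have "3 * a + 4 * b + 6 * c + h \<le> n" using that unfolding theta of_nat_le_iff by simp
    then have "A_count n + b = K + 2 * c + h + 1" using A bounds by simp
    then have "2 * A_count n + k + 9 = 3 * a + 5 * b + 8 * c" using K bounds by linarith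
    from arg_cong[OF this, of real] show ?thesis unfolding t by (simp add: k field_simps)
  qed
qed

end
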